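(* Let $(W,S)$ be a Coxeter system, $s\in S$, and $u,w\in W$ with $ws>w$, $us>u$ and $u\le w$ in Bruhat order. If $us\notin[u,w]$, then $[u,ws]\cong[u,w]\times[1,s]$ and $[us,ws]\cong[u,w]$. If $us\in[u,w]$, then $[u,ws]$ can be obtained (up to isomorphism of posets) from $[u,w]\times[1,s]$ by a (possibly empty) sequence of zippings, and $[us,ws]$ can be obtained (up to isomorphism of posets) from $\mathrm{Sh}_{us}[u,w]$ by a (possibly empty) sequence of zippings.
   Context: All intervals are intervals in the Bruhat order on $W$: fixing a reduced word $s_1\cdots s_k$ for $w$, $v\le w$ iff some subword $s_{i_1}\cdots s_{i_j}$ ($1\le i_1<\cdots<i_j\le k$) is a reduced word for $v$. $1$ denotes the identity, so $[1,s]=\{1,s\}$ is a two-element chain. Products of posets carry the componentwise order. Zipping. All posets are finite. For an element $x$ of a poset $P$ let $D(x)=\{y\in P: y<x\}$. A zipper in $P$ is a triple of distinct elements $x,y,z\in P$ such that (i) $z$ covers $x$ and $y$ but covers no other element; (ii) $z=x\vee y$, i.e. $z$ is the least element of $\{p: p\ge x, p\ge y\}$; (iii) $D(x)=D(y)$. To zip the zipper $(x,y,z)$, let $xy$ be a new element and replace $P$ by $P'=(P\setminus\{x,y,z\})\cup\{xy\}$ with relation $\preceq$: for $a,b\in P'\setminus\{xy\}$, $a\preceq b$ iff $a\le b$; $xy\preceq a$ iff $x\le a$ or $y\le a$; $a\preceq xy$ iff $a\le x$ (equivalently $a\le y$); and $xy\preceq xy$. A zipping is the passage from $P$ to $P'$.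 Shaving. For a poset $P$ with minimum $\hat 0$ and maximum $\hat 1$ and an atom $a$, $\mathrm{Sh}_a(P)$ is the induced subposet of $P\times[\hat 0,a]$ on the set $$\big((P\setminus\{\hat 0,a\})\times\{a\}\big)\cup\big((a,\hat 1]\times\{\hat 0\}\big)\cup\{(\hat 0,\hat 0)\}.$$ When $us\in[u,w]$, $us$ is an atom of $[u,w]$. *)

theory Defs
  imports "HOL-Algebra.Generated_Groups" "HOL-Library.Extended_Nat" "HOL-Library.Sublist"
begin

section \<open>Coxeter systems\<close>

definition coxeter_matrix :: "'a set \<Rightarrow> ('a \<Rightarrow> 'a \<Rightarrow> enat) \<Rightarrow> bool" where
  "coxeter_matrix S m \<longleftrightarrow>
     (\<forall>s\<in>S. m s s = 1) \<and>
     (\<forall>s\<in>S. \<forall>t\<in>S. m s t = m t s) \<and>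
     (\<forall>s\<in>S. \<forall>t\<in>S. s \<noteq> t \<longrightarrow> 2 \<le> m s t)"

text \<open>
  Insertion of one relator \<open>(s t)\<^sup>m\<^sup>(\<^sup>s\<^sup>,\<^sup>t\<^sup>)\<close> with finite exponent into a word.
\<close>

definition coxeter_step :: "'a set \<Rightarrow> ('a \<Rightarrow> 'a \<Rightarrow> enat) \<Rightarrow> 'a list \<Rightarrow> 'a list \<Rightarrow> bool" where
  "coxeter_step S m xs ys \<longleftrightarrow>
     (\<exists>as bs s t k. s \<in> S \<and> t \<in> S \<and> m s t = enat k \<and>
        xs = as @ bs \<and> ys = as @ concat (replicate k [s, t]) @ bs)"

definition word_prod :: "('a, 'b) monoid_scheme \<Rightarrow> 'a list \<Rightarrow> 'a" where
  "word_prod W xs = foldr (\<otimes>\<^bsub>W\<^esub>) xs \<one>\<^bsub>W\<^esub>"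

text \<open>
  \<open>W\<close> is the group presented by the generators \<open>S\<close> and the relations
  \<open>(s t)\<^sup>m\<^sup>(\<^sup>s\<^sup>,\<^sup>t\<^sup>) = 1\<close> for \<open>m(s,t) < \<infinity>\<close>: two words in the generators
  have the same product iff they are connected by insertions and deletions of relators.
  Words in \<open>S\<close> suffice, with no formal inverses, because the relators \<open>s s\<close> (from
  \<open>m(s,s) = 1\<close>) make every generator its own inverse. The set \<open>S\<close> may be infinite.
\<close>

definition coxeter_system :: "('a, 'b) monoid_scheme \<Rightarrow> 'a set \<Rightarrow> bool" where
  "coxeter_system W S \<longleftrightarrow>
     group W \<and> S \<subseteq> carrier W \<and> generate W S = carrier W \<and>
     (\<exists>m. coxeter_matrix S m \<and>
        (\<forall>xs\<in>lists S. \<forall>ys\<in>lists S.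
           word_prod W xs = word_prod W ys \<longleftrightarrow> equivclp (coxeter_step S m) xs ys))"

section \<open>Bruhat order\<close>

definition reduced_word :: "('a, 'b) monoid_scheme \<Rightarrow> 'a set \<Rightarrow> 'a \<Rightarrow> 'a list \<Rightarrow> bool" where
  "reduced_word W S w xs \<longleftrightarrow>
     xs \<in> lists S \<and> word_prod W xs = w \<and>
     (\<forall>ys\<in>lists S. word_prod W ys = w \<longrightarrow> length xs \<le> length ys)"

text \<open>
  The reduced word of \<open>w\<close> is quantified existentially; by the subword property the
  relation does not depend on the choice.
\<close>

definition bruhat_le :: "('a, 'b) monoid_scheme \<Rightarrow> 'a set \<Rightarrow> 'a \<Rightarrow> 'a \<Rightarrow> bool" where
  "bruhat_le W S v w \<longleftrightarrow>
     (\<exists>xs ys. reduced_word W S w xs \<and> reduced_word W S v ys \<and> subseq ys xs)"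

definition bruhat_less :: "('a, 'b) monoid_scheme \<Rightarrow> 'a set \<Rightarrow> 'a \<Rightarrow> 'a \<Rightarrow> bool" where
  "bruhat_less W S v w \<longleftrightarrow> bruhat_le W S v w \<and> v \<noteq> w"

section \<open>Posets\<close>

text \<open>
  A poset is represented by its reflexive order relation \<open>P\<close>; its underlying set is
  \<open>Field P\<close>.
\<close>

definition finite_poset :: "'a rel \<Rightarrow> bool" where
  "finite_poset P \<longleftrightarrow> finite (Field P) \<and> Partial_order P"

text \<open>
  The library notion \<open>iso\<close> is stated for arbitrary relations; the lemma
  \<open>iso_iff2\<close> shows that it is order isomorphism in the usual sense.
\<close>

definition poset_iso :: "'a rel \<Rightarrow> 'b rel \<Rightarrow> bool" where
  "poset_iso P Q \<longleftrightarrow> (\<exists>f. BNF_Wellorder_Embedding.iso P Q f)"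

definition poset_interval :: "'a rel \<Rightarrow> 'a \<Rightarrow> 'a \<Rightarrow> 'a rel" where
  "poset_interval P a b = Restr P (above P a \<inter> under P b)"

definition poset_prod :: "'a rel \<Rightarrow> 'b rel \<Rightarrow> ('a \<times> 'b) rel" where
  "poset_prod P Q = {((a, b), (a', b')). (a, a') \<in> P \<and> (b, b') \<in> Q}"

definition poset_covers :: "'a rel \<Rightarrow> 'a \<Rightarrow> 'a \<Rightarrow> bool" where
  "poset_covers P z x \<longleftrightarrow> x \<in> underS P z \<and> \<not> (\<exists>p. x \<in> underS P p \<and> p \<in> underS P z)"

definition is_least :: "'a rel \<Rightarrow> 'a set \<Rightarrow> 'a \<Rightarrow> bool" where
  "is_least P A a \<longleftrightarrow> a \<in> A \<and> (\<forall>b\<in>A. (a, b) \<in> P)"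

definition poset_bot :: "'a rel \<Rightarrow> 'a" where
  "poset_bot P = (THE a. is_least P (Field P) a)"

definition poset_top :: "'a rel \<Rightarrow> 'a" where
  "poset_top P = (THE a. is_least (P\<inverse>) (Field P) a)"

definition bruhat_order :: "('a, 'b) monoid_scheme \<Rightarrow> 'a set \<Rightarrow> 'a rel" where
  "bruhat_order W S = relation_of (bruhat_le W S) (carrier W)"

definition bruhat_interval :: "('a, 'b) monoid_scheme \<Rightarrow> 'a set \<Rightarrow> 'a \<Rightarrow> 'a \<Rightarrow> 'a rel" where
  "bruhat_interval W S u w = poset_interval (bruhat_order W S) u w"

section \<open>Zipping\<close>

definition zipper :: "'a rel \<Rightarrow> 'a \<Rightarrow> 'a \<Rightarrow> 'a \<Rightarrow> bool" where
  "zipper P x y z \<longleftrightarrow>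
     finite_poset P \<and> {x, y, z} \<subseteq> Field P \<and> distinct [x, y, z] \<and>
     (\<forall>p. poset_covers P z p \<longleftrightarrow> p = x \<or> p = y) \<and>
     is_least P (above P x \<inter> above P y) z \<and>
     underS P x = underS P y"

text \<open>
  The new element \<open>xy\<close> is \<open>None\<close>; the remaining elements \<open>a\<close> of \<open>P\<close> become \<open>Some a\<close>.
\<close>

definition zip_poset :: "'a rel \<Rightarrow> 'a \<Rightarrow> 'a \<Rightarrow> 'a \<Rightarrow> 'a option rel" where
  "zip_poset P x y z = (let R = Field P - {x, y, z} in
     {(Some a, Some b) | a b. a \<in> R \<and> b \<in> R \<and> (a, b) \<in> P} \<union>
     {(None, Some a) | a. a \<in> R \<and> ((x, a) \<in> P \<or> (y, a) \<in> P)} \<union>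
     {(Some a, None) | a. a \<in> R \<and> (a, x) \<in> P} \<union>
     {(None, None)})"

text \<open>
  To iterate zippings within one type, the result of each zipping is replaced by an isomorphic
  copy on the original type. A zipping of a finite poset has fewer elements than the poset, so
  such a copy always exists.
\<close>

definition zipping :: "'a rel \<Rightarrow> 'a rel \<Rightarrow> bool" where
  "zipping P P' \<longleftrightarrow> (\<exists>x y z. zipper P x y z \<and> poset_iso (zip_poset P x y z) P')"

definition obtained_by_zippings :: "'a rel \<Rightarrow> 'b rel \<Rightarrow> bool" where
  "obtained_by_zippings P Q \<longleftrightarrow> (\<exists>P'. zipping\<^sup>*\<^sup>* P P' \<and> poset_iso P' Q)"

section \<open>Shaving\<close>

text \<open>
  Meaningful if \<open>P\<close> has a minimum and a maximum and \<open>a\<close> is an atom of \<open>P\<close>.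
\<close>

definition shaving :: "'a rel \<Rightarrow> 'a \<Rightarrow> ('a \<times> 'a) rel" where
  "shaving P a = (let o0 = poset_bot P; o1 = poset_top P in
     Restr (poset_prod P (poset_interval P o0 a))
       ((Field P - {o0, a}) \<times> {a} \<union>
        {p. a \<in> underS P p \<and> (p, o1) \<in> P} \<times> {o0} \<union>
        {(o0, o0)}))"

end

theory Submission
  imports Defs
begin

text \<open>
  Write \<open>\<sigma> x = x s\<close>. The engine of the proof is the lifting property of the Bruhat order: if \<open>x \<le> y\<close> and
  \<open>\<sigma> y < y\<close>, then \<open>\<sigma> x \<le> y\<close>, and if moreover \<open>x < \<sigma> x\<close>, then \<open>x \<le> \<sigma> y\<close>. It makes the map
  \<open>(x, 1) \<mapsto> x\<close>, \<open>(x, s) \<mapsto> max {x, \<sigma> x}\<close> an order preserving surjection of \<open>[u, w] \<times> [1, s]\<close> onto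
  \<open>[u, \<sigma> w]\<close>. Its fibres are points, except that each descent \<open>v \<in> [u, w]\<close> (that is, \<open>\<sigma> v < v\<close>) has
  the fibre \<open>(v, 1)\<close>, \<open>(\<sigma> v, s)\<close>, \<open>(v, s)\<close>. If these triples are collapsed in an order in which smaller
  descents come first, each of them is a zipper at the moment of its collapse: what else \<open>(v, s)\<close>
  covered in the product has meanwhile been merged into elements below \<open>(v, 1)\<close>, and the same
  mergers have made the sets strictly below \<open>(v, 1)\<close> and strictly below \<open>(\<sigma> v, s)\<close> equal. The intermediate posets have an
  explicit description, \<open>stage K A\<close>, where \<open>A\<close> is the set of descents treated so far, so that no
  iterated quotients occur; the key facts are \<open>stage_zipper\<close>, \<open>zip_stage\<close> and \<open>stage_final\<close>.

  The shaving of \<open>[u, w]\<close> at \<open>\<sigma> u\<close> is the part of the product, with the triple of \<open>\<sigma> u\<close> zipped, that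
  lies above the merged element. So the same zippings, for the descents other than \<open>\<sigma> u\<close>, lead from
  it to \<open>[\<sigma> u, \<sigma> w]\<close> (\<open>stage_shaving\<close>, \<open>stage_bottom\<close>). If \<open>\<sigma> u\<close> is not below \<open>w\<close>, then there are no
  descents, because lifting puts \<open>\<sigma> u\<close> below each of them; so nothing is zipped and the posets are
  isomorphic.

  The lifting property is derived from the presentation. To a word is attached the sequence of
  reflections that delete one of its letters; the parity with which a reflection occurs in it depends
  only on the group element, since a relator contributes every reflection an even number of times.
  This yields the strong exchange property (\<open>strong_exchange\<close>), hence the deletion property and the
  description of the Bruhat order as the reachability relation of the Bruhat graph
  (\<open>bruhat_le_iff\<close>), for which lifting can be proved (\<open>arrows_lift\<close>, \<open>bruhat_lift_up\<close>).
\<close>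

section \<open>Isomorphisms and zippings of posets\<close>

lemma poset_isoI:
  assumes "bij_betw f (Field P) (Field Q)"
    and "\<And>a b. a \<in> Field P \<Longrightarrow> b \<in> Field P \<Longrightarrow> (a, b) \<in> P \<longleftrightarrow> (f a, f b) \<in> Q"
  shows "poset_iso P Q"
  unfolding poset_iso_def iso_iff2 using assms by blast

lemma poset_iso_trans:
  assumes "poset_iso P Q" "poset_iso Q R"
  shows "poset_iso P R"
proof -
  obtain f where f: "bij_betw f (Field P) (Field Q)"
    "\<And>a b. a \<in> Field P \<Longrightarrow> b \<in> Field P \<Longrightarrow> (a, b) \<in> P \<longleftrightarrow> (f a, f b) \<in> Q"
    using assms(1) unfolding poset_iso_def iso_iff2 by blast
  obtain g where g: "bij_betw g (Field Q) (Field R)"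
    "\<And>a b. a \<in> Field Q \<Longrightarrow> b \<in> Field Q \<Longrightarrow> (a, b) \<in> Q \<longleftrightarrow> (g a, g b) \<in> R"
    using assms(2) unfolding poset_iso_def iso_iff2 by blast
  show ?thesis
    by (rule poset_isoI[of "g \<circ> f"]) (use f g bij_betw_trans bij_betwE[OF f(1)] in auto)
qed

lemma poset_iso_sym: "poset_iso P Q \<Longrightarrow> poset_iso Q P"
proof -
  assume "poset_iso P Q"
  then obtain f where f: "bij_betw f (Field P) (Field Q)"
    "\<And>a b. a \<in> Field P \<Longrightarrow> b \<in> Field P \<Longrightarrow> (a, b) \<in> P \<longleftrightarrow> (f a, f b) \<in> Q"
    unfolding poset_iso_def iso_iff2 by blast
  let ?g = "inv_into (Field P) f"
  show ?thesis
  proof (rule poset_isoI)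
    show "bij_betw ?g (Field Q) (Field P)" using f(1) by (rule bij_betw_inv_into)
    fix a b assume *: "a \<in> Field Q" "b \<in> Field Q"
    then have "?g a \<in> Field P" "?g b \<in> Field P"
      using bij_betwE[OF bij_betw_inv_into[OF f(1)]] by blast+
    then show "(a, b) \<in> Q \<longleftrightarrow> (?g a, ?g b) \<in> P"
      using f(2) bij_betw_inv_into_right[OF f(1)] * by metis
  qed
qed

lemma in_zip_poset:
  "(None, None) \<in> zip_poset P x y z"
  "(Some a, Some b) \<in> zip_poset P x y z \<longleftrightarrow>
     a \<in> Field P - {x, y, z} \<and> b \<in> Field P - {x, y, z} \<and> (a, b) \<in> P"
  "(None, Some a) \<in> zip_poset P x y z \<longleftrightarrow> a \<in> Field P - {x, y, z} \<and> ((x, a) \<in> P \<or> (y, a) \<in> P)"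
  "(Some a, None) \<in> zip_poset P x y z \<longleftrightarrow> a \<in> Field P - {x, y, z} \<and> (a, x) \<in> P"
  by (auto simp: zip_poset_def Let_def)

lemma Field_zip_poset:
  assumes "Refl P"
  shows "Field (zip_poset P x y z) = insert None (Some ` (Field P - {x, y, z}))"
proof
  show "Field (zip_poset P x y z) \<subseteq> insert None (Some ` (Field P - {x, y, z}))"
    unfolding zip_poset_def Let_def by (auto simp: Field_def)
  have "(p, p) \<in> zip_poset P x y z" if "p \<in> insert None (Some ` (Field P - {x, y, z}))" for p
    using that assms by (auto simp: in_zip_poset refl_on_def)
  then show "insert None (Some ` (Field P - {x, y, z})) \<subseteq> Field (zip_poset P x y z)"
    by (meson FieldI1 subsetI)
qed


section \<open>Words in a Coxeter group\<close>

lemma word_prod_Nil [simp]: "word_prod W [] = \<one>\<^bsub>W\<^esub>"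
  by (simp add: word_prod_def)

lemma word_prod_Cons [simp]: "word_prod W (x # xs) = x \<otimes>\<^bsub>W\<^esub> word_prod W xs"
  by (simp add: word_prod_def)

lemma subseq_set: "subseq ys xs \<Longrightarrow> set ys \<subseteq> set xs"
  by (induction rule: list_emb.induct) auto

lemma subseq_snocE:
  assumes "subseq ys (xs @ [s])"
  obtains "subseq ys xs" | ys' where "ys = ys' @ [s]" "subseq ys' xs"
proof -
  obtain as bs where *: "ys = as @ bs" "subseq as xs" "subseq bs [s]"
    using assms by (auto simp: subseq_append_iff)
  then have "bs = [] \<or> bs = [s]" by (cases bs) (auto split: if_splits simp: subseq_Cons2_iff list_emb_Nil2)
  then show thesis using that * by auto
qed

locale coxeter = group W for W (structure) +
  fixes S :: "'a set"
  assumes system: "coxeter_system W S"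
begin

abbreviation wp where "wp \<equiv> word_prod W"

lemma gen_carrier: "S \<subseteq> carrier W" and generate_eq: "generate W S = carrier W"
  using system by (auto simp: coxeter_system_def)

lemma gen_closed [simp]: "s \<in> S \<Longrightarrow> s \<in> carrier W"
  using gen_carrier by auto

lemma wp_closed [simp]: "set xs \<subseteq> S \<Longrightarrow> wp xs \<in> carrier W"
  by (induction xs) auto

lemma wp_append [simp]:
  "set xs \<subseteq> S \<Longrightarrow> set ys \<subseteq> S \<Longrightarrow> wp (xs @ ys) = wp xs \<otimes> wp ys"
  by (induction xs) (auto simp: m_assoc)

text \<open>
  The definition of a Coxeter system asserts only that a Coxeter matrix exists; one is chosen.
\<close>

definition mat where
  "mat = (SOME mat. coxeter_matrix S mat \<and> (\<forall>xs\<in>lists S. \<forall>ys\<in>lists S.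
           wp xs = wp ys \<longleftrightarrow> equivclp (coxeter_step S mat) xs ys))"

lemma mat: "coxeter_matrix S mat"
  and wp_eq_iff: "set xs \<subseteq> S \<Longrightarrow> set ys \<subseteq> S \<Longrightarrow>
     wp xs = wp ys \<longleftrightarrow> equivclp (coxeter_step S mat) xs ys"
proof -
  have "\<exists>mat. coxeter_matrix S mat \<and> (\<forall>xs\<in>lists S. \<forall>ys\<in>lists S.
           wp xs = wp ys \<longleftrightarrow> equivclp (coxeter_step S mat) xs ys)"
    using system by (simp add: coxeter_system_def)
  from someI_ex[OF this, folded mat_def]
  show "coxeter_matrix S mat" "set xs \<subseteq> S \<Longrightarrow> set ys \<subseteq> S \<Longrightarrow>
     wp xs = wp ys \<longleftrightarrow> equivclp (coxeter_step S mat) xs ys"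
    by (auto simp: lists_eq_set)
qed

lemma set_relator: "s \<in> S \<Longrightarrow> t \<in> S \<Longrightarrow> set (concat (replicate k [s, t])) \<subseteq> S"
  by (induction k) auto

lemma wp_relator:
  assumes "s \<in> S" "t \<in> S" "mat s t = enat k"
  shows "wp (concat (replicate k [s, t])) = \<one>"
proof -
  have "coxeter_step S mat [] (concat (replicate k [s, t]))"
    unfolding coxeter_step_def using assms
    by (intro exI[of _ "[]"] exI[of _ s] exI[of _ t] exI[of _ k]) auto
  then have "equivclp (coxeter_step S mat) [] (concat (replicate k [s, t]))" by blast
  then have "wp [] = wp (concat (replicate k [s, t]))"
    using set_relator[OF assms(1,2)] by (subst wp_eq_iff) auto
  then show ?thesis by simp
qed

lemma gen_sq [simp]: "s \<in> S \<Longrightarrow> s \<otimes> s = \<one>"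
  using wp_relator[of s s 1] mat by (auto simp: coxeter_matrix_def one_enat_def)

lemma gen_inv [simp]: "s \<in> S \<Longrightarrow> inv s = s"
  by (simp add: inv_equality)

lemma wp_rev: "set xs \<subseteq> S \<Longrightarrow> wp (rev xs) = inv (wp xs)"
  by (induction xs) (auto simp: inv_mult_group)

lemma word_exists:
  assumes "w \<in> carrier W"
  shows "\<exists>xs. set xs \<subseteq> S \<and> wp xs = w"
proof -
  have "w \<in> generate W S" using assms generate_eq by simp
  then show ?thesis
  proof induction
    case one
    then show ?case by (intro exI[of _ "[]"]) simp
  next
    case (incl h)
    then show ?case by (intro exI[of _ "[h]"]) simp
  next
    case (inv h)
    then show ?case by (intro exI[of _ "[h]"]) simp
  next
    case (eng h1 h2)
    then obtain xs ys where "set xs \<subseteq> S \<and> wp xs = h1" "set ys \<subseteq> S \<and> wp ys = h2" by blast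
    then show ?case by (intro exI[of _ "xs @ ys"]) simp
  qed
qed

text \<open>
  This is the only way in which the presentation is used: a quantity attached to words that no
  insertion of a relator changes depends only on the product of the word. It is applied to the
  parity of the length and to the parities of the multiplicities in \<open>refls\<close>.
\<close>

lemma word_invariant:
  assumes step: "\<And>as bs s t k. \<lbrakk>set as \<subseteq> S; set bs \<subseteq> S; s \<in> S; t \<in> S; mat s t = enat k\<rbrakk>
      \<Longrightarrow> f (as @ concat (replicate k [s, t]) @ bs) = f (as @ bs)"
    and "set xs \<subseteq> S" "set ys \<subseteq> S" "wp xs = wp ys"
  shows "f xs = f ys"
proof -
  have one: "(set a \<subseteq> S \<longleftrightarrow> set b \<subseteq> S) \<and> (set a \<subseteq> S \<longrightarrow> f a = f b)"
    if "coxeter_step S mat a b" for a b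
  proof -
    from that obtain as bs s t k where *: "s \<in> S" "t \<in> S" "mat s t = enat k"
      "a = as @ bs" "b = as @ concat (replicate k [s, t]) @ bs"
      unfolding coxeter_step_def by blast
    show ?thesis
      using set_relator[OF *(1,2), of k] step[OF _ _ *(1-3), of as bs] *(4,5) by auto
  qed
  have "equivclp (coxeter_step S mat) xs ys" using assms wp_eq_iff by blast
  then have "set ys \<subseteq> S \<and> f xs = f ys"
  proof (induction rule: equivclp_induct)
    case base
    then show ?case using assms by simp
  next
    case (step y z)
    then show ?case using one[of y z] one[of z y] by auto
  qed
  then show ?thesis by simp
qed

lemma word_parity:
  assumes "set xs \<subseteq> S" "set ys \<subseteq> S" "wp xs = wp ys"
  shows "even (length xs) = even (length ys)"
proof (rule word_invariant[OF _ assms])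
  fix as bs :: "'a list" and s t k
  show "even (length (as @ concat (replicate k [s, t]) @ bs)) = even (length (as @ bs))"
    by (induction k) auto
qed

section \<open>Reflections and the strong exchange property\<close>

definition conjugate where "conjugate g t = inv g \<otimes> t \<otimes> g"

lemma conjugate_closed [simp]: "g \<in> carrier W \<Longrightarrow> t \<in> carrier W \<Longrightarrow> conjugate g t \<in> carrier W"
  by (simp add: conjugate_def)

lemma conjugate_mult: "g \<in> carrier W \<Longrightarrow> h \<in> carrier W \<Longrightarrow> t \<in> carrier W \<Longrightarrow>
    conjugate h (conjugate g t) = conjugate (g \<otimes> h) t"
  by (simp add: conjugate_def inv_mult_group m_assoc)

lemma conjugate_eq_iff: "g \<in> carrier W \<Longrightarrow> t \<in> carrier W \<Longrightarrow> t' \<in> carrier W \<Longrightarrow>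
    conjugate g t = t' \<longleftrightarrow> t = conjugate (inv g) t'"
  by (metis conjugate_def conjugate_mult inv_closed inv_inv inv_one l_inv l_one one_closed r_inv r_one)

text \<open>
  The entry of \<open>refls xs\<close> that belongs to a letter of \<open>xs\<close> is the reflection \<open>t\<close> for which
  \<open>wp xs \<otimes> t\<close> is the product of \<open>xs\<close> with this letter deleted (\<open>refls_delete\<close>). These are the
  candidates for the reflections that make \<open>wp xs\<close> shorter.
\<close>

fun refls where
  "refls [] = []"
| "refls (x # xs) = conjugate (wp xs) x # refls xs"

lemma refls_closed: "set xs \<subseteq> S \<Longrightarrow> set (refls xs) \<subseteq> carrier W"
  by (induction xs) auto

lemma refls_append:
  "set xs \<subseteq> S \<Longrightarrow> set ys \<subseteq> S \<Longrightarrow>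
    refls (xs @ ys) = map (conjugate (wp ys)) (refls xs) @ refls ys"
  by (induction xs) (auto simp: conjugate_mult)

lemma count_map_conjugate:
  assumes "set l \<subseteq> carrier W" "g \<in> carrier W" "t \<in> carrier W"
  shows "count_list (map (conjugate g) l) t = count_list l (conjugate (inv g) t)"
  using assms by (induction l) (auto simp: conjugate_eq_iff)

lemma count_refls_append:
  assumes "set xs \<subseteq> S" "set ys \<subseteq> S" "t \<in> carrier W"
  shows "count_list (refls (xs @ ys)) t =
     count_list (refls xs) (conjugate (inv (wp ys)) t) + count_list (refls ys) t"
  using assms by (simp add: refls_append count_map_conjugate refls_closed)

lemma wp_alternating:
  assumes "s \<in> S" "t \<in> S"
  shows "wp (concat (replicate k [s, t])) = (s \<otimes> t) [^] k"
proof (induction k)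
  case (Suc k)
  have "wp (concat (replicate (Suc k) [s, t])) = (s \<otimes> t) \<otimes> (s \<otimes> t) [^] k"
    using Suc assms by (simp add: m_assoc)
  also have "\<dots> = (s \<otimes> t) [^] Suc k"
    by (rule nat_pow_Suc2[symmetric]) (use assms in auto)
  finally show ?case .
qed simp

text \<open>
  Read from the right, the sequence of \<open>(s t)\<^sup>k\<close> is \<open>t\<close>, \<open>t s t\<close>, \<open>t s t s t\<close>, \<dots>, and these words are
  \<open>(t s)\<^sup>j t\<close>. In this form it is visible that \<open>(s t)\<^sup>k = \<one>\<close> makes the sequence periodic with
  period \<open>k\<close>, which is half its length.
\<close>

lemma refls_alternating:
  assumes st: "s \<in> S" "t \<in> S"
  shows "refls (concat (replicate k [s, t])) = rev (map (\<lambda>j. (t \<otimes> s) [^] j \<otimes> t) [0..<2 * k])"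
proof (induction k)
  case (Suc k)
  have [simp]: "s \<in> carrier W" "t \<in> carrier W" using st by auto
  define a where "a = t \<otimes> s"
  define b where "b = s \<otimes> t"
  have [simp]: "a \<in> carrier W" "b \<in> carrier W" using st by (auto simp: a_def b_def)
  have inv_b: "inv (b [^] j) = a [^] j" for j :: nat
    using st by (metis (no_types) a_def b_def gen_closed gen_inv inv_mult_group m_closed nat_pow_inv)
  have tb: "t \<otimes> b [^] j = a [^] j \<otimes> t" for j :: nat
  proof (induction j)
    case (Suc j)
    have "t \<otimes> b [^] Suc j = (t \<otimes> b [^] j) \<otimes> b" by (simp add: m_assoc)
    also have "\<dots> = a [^] j \<otimes> (t \<otimes> (s \<otimes> t))" unfolding Suc by (simp add: m_assoc b_def)
    also have "\<dots> = a [^] Suc j \<otimes> t" by (simp add: m_assoc a_def)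
    finally show ?case .
  qed simp
  have 1: "conjugate (b [^] k) t = a [^] (2 * k) \<otimes> t"
  proof -
    have "conjugate (b [^] k) t = a [^] k \<otimes> (t \<otimes> b [^] k)" by (simp add: conjugate_def inv_b m_assoc)
    also have "\<dots> = a [^] k \<otimes> a [^] k \<otimes> t" by (simp add: tb m_assoc)
    finally show ?thesis by (simp add: nat_pow_mult mult_2)
  qed
  have 2: "conjugate (t \<otimes> b [^] k) s = a [^] (2 * k + 1) \<otimes> t"
  proof -
    have "conjugate (t \<otimes> b [^] k) s = a [^] k \<otimes> (t \<otimes> s) \<otimes> (t \<otimes> b [^] k)"
      using st by (simp add: conjugate_def inv_mult_group inv_b m_assoc)
    also have "\<dots> = a [^] Suc k \<otimes> a [^] k \<otimes> t"
      by (simp add: tb m_assoc flip: a_def)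
    also have "\<dots> = a [^] (2 * k + 1) \<otimes> t" by (simp only: nat_pow_mult \<open>a \<in> carrier W\<close>) (simp add: mult_2)
    finally show ?thesis .
  qed
  show ?case
    using 1 2 Suc wp_alternating[OF st] by (simp add: a_def b_def)
qed simp

lemma refls_relator:
  assumes st: "s \<in> S" "t \<in> S" "mat s t = enat k"
  shows "\<exists>l. refls (concat (replicate k [s, t])) = l @ l"
proof -
  let ?f = "\<lambda>j. (t \<otimes> s) [^] j \<otimes> t"
  have "(s \<otimes> t) [^] k = \<one>" using wp_relator[OF st] wp_alternating[OF st(1,2)] by metis
  then have "inv ((s \<otimes> t) [^] k) = \<one>" by simp
  then have 1: "(t \<otimes> s) [^] k = \<one>"
    using st by (metis gen_closed gen_inv inv_mult_group m_closed nat_pow_inv)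
  have per: "?f (j + k) = ?f j" for j
    using st 1 by (simp flip: nat_pow_mult)
  have "map ?f [0..<2 * k] = map ?f [0..<k] @ map ?f [0..<k]"
    by (rule nth_equalityI) (use per in \<open>auto simp: nth_append, metis le_add_diff_inverse2 not_less\<close>)
  then show ?thesis using refls_alternating[OF st(1,2)] by (metis rev_append)
qed

text \<open>
  A relator has trivial product, so its insertion leaves the entries of the other letters alone
  and adds a conjugate of a sequence of the form \<open>l @ l\<close>. Hence the parity of each multiplicity is
  an invariant of the group element.
\<close>

lemma refls_parity:
  assumes "set xs \<subseteq> S" "set ys \<subseteq> S" "wp xs = wp ys"
  shows "even (count_list (refls xs) t) = even (count_list (refls ys) t)"
proof (rule word_invariant[OF _ assms])
  fix as bs s t' k
  assume *: "set as \<subseteq> S" "set bs \<subseteq> S" "s \<in> S" "t' \<in> S" "mat s t' = enat k"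
  obtain l where l: "refls (concat (replicate k [s, t'])) = l @ l" using refls_relator * by blast
  show "even (count_list (refls (as @ concat (replicate k [s, t']) @ bs)) t) =
        even (count_list (refls (as @ bs)) t)"
    using * set_relator[OF *(3,4), of k]
    by (simp add: refls_append wp_relator l del: set_concat set_replicate_conv_if) (metis even_add)
qed

definition reflections where "reflections = {conjugate x s | x s. x \<in> carrier W \<and> s \<in> S}"

lemma reflectionE:
  assumes "t \<in> reflections"
  obtains x s where "x \<in> carrier W" "s \<in> S" "t = conjugate x s"
  using assms unfolding reflections_def by blast

lemma conjugate_one [simp]: "t \<in> carrier W \<Longrightarrow> conjugate \<one> t = t"
  by (simp add: conjugate_def)

lemma gen_reflection: "s \<in> S \<Longrightarrow> s \<in> reflections"
  unfolding reflections_def unfolding mem_Collect_eq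
  by (intro exI[of _ \<one>] exI[of _ s]) simp

lemma reflection_closed [simp]: "t \<in> reflections \<Longrightarrow> t \<in> carrier W"
  by (erule reflectionE) simp

lemma conjugate_reflection:
  assumes "t \<in> reflections" "g \<in> carrier W"
  shows "conjugate g t \<in> reflections"
proof -
  obtain x s where "x \<in> carrier W" "s \<in> S" "t = conjugate x s"
    by (rule reflectionE[OF assms(1)])
  then show ?thesis
    using assms unfolding reflections_def mem_Collect_eq
    by (intro exI[of _ "x \<otimes> g"] exI[of _ s]) (simp add: conjugate_mult)
qed

lemma reflection_sq: "t \<in> reflections \<Longrightarrow> t \<otimes> t = \<one>"
proof -
  assume "t \<in> reflections"
  then obtain x s where *: "x \<in> carrier W" "s \<in> S" "t = conjugate x s" by (rule reflectionE)
  have "t \<otimes> t = inv x \<otimes> s \<otimes> (x \<otimes> inv x) \<otimes> s \<otimes> x" using * by (simp add: conjugate_def m_assoc del: r_inv Units_r_inv)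
  also have "\<dots> = inv x \<otimes> (s \<otimes> s) \<otimes> x" using * by (simp add: m_assoc del: gen_sq)
  finally show ?thesis using * by simp
qed

text \<open>
  For \<open>t = x\<^sup>-\<^sup>1 s x\<close>, the palindromic word of the product \<open>x\<^sup>-\<^sup>1 \<cdot> s \<cdot> x\<close> is used. The
  contributions of \<open>x\<^sup>-\<^sup>1\<close> and \<open>x\<close> to the multiplicity of \<open>t\<close> have an even sum, because they are those of
  the word \<open>x\<^sup>-\<^sup>1 x\<close> of the identity, and the middle letter contributes one.
\<close>

lemma reflection_word:
  assumes "t \<in> reflections"
  shows "\<exists>zs. set zs \<subseteq> S \<and> wp zs = t \<and> odd (length zs) \<and> odd (count_list (refls zs) t)"
proof -
  obtain x s where *: "x \<in> carrier W" "s \<in> S" "t = conjugate x s" by (rule reflectionE[OF assms])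
  obtain xs where xs: "set xs \<subseteq> S" "wp xs = x" using word_exists * by blast
  have [simp]: "s \<in> carrier W" using * by simp
  let ?zs = "rev xs @ [s] @ xs"
  have conjugate_inv: "conjugate (inv x) t = s" using * by (metis conjugate_eq_iff gen_closed conjugate_closed)
  have "even (count_list (refls (rev xs @ xs)) t) = even (count_list (refls []) t)"
    by (rule refls_parity) (use xs in \<open>auto simp: wp_rev\<close>)
  then have "even (count_list (refls (rev xs)) s + count_list (refls xs) t)"
    using xs conjugate_inv * by (simp add: count_refls_append)
  moreover have "conjugate s s = s" "conjugate \<one> s = s" using * by (auto simp: conjugate_def)
  then have "count_list (refls ?zs) t = count_list (refls (rev xs)) s + 1 + count_list (refls xs) t"
    using xs conjugate_inv * count_refls_append[of "rev xs @ [s]" xs t] count_refls_append[of "rev xs" "[s]" s]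
    by simp
  moreover have "wp ?zs = t" using xs * by (simp add: wp_rev conjugate_def m_assoc)
  ultimately show ?thesis using xs * by (intro exI[of _ ?zs]) auto
qed

lemma refls_delete:
  assumes "set xs \<subseteq> S" "t \<in> set (refls xs)"
  shows "\<exists>as a bs. xs = as @ a # bs \<and> wp xs \<otimes> t = wp (as @ bs)"
  using assms
proof (induction xs)
  case (Cons x xs)
  show ?case
  proof (cases "t = conjugate (wp xs) x")
    case True
    have "wp (x # xs) \<otimes> t = x \<otimes> (wp xs \<otimes> inv (wp xs)) \<otimes> x \<otimes> wp xs"
      using Cons True by (simp add: conjugate_def m_assoc del: r_inv Units_r_inv)
    also have "\<dots> = (x \<otimes> x) \<otimes> wp xs" using Cons by (simp del: gen_sq)
    also have "\<dots> = wp xs" using Cons by simp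
    finally show ?thesis by (intro exI[of _ "[]"] exI) auto
  next
    case False
    then obtain as a bs where *: "xs = as @ a # bs" "wp xs \<otimes> t = wp (as @ bs)"
      using Cons by auto
    have "t \<in> carrier W" using Cons False refls_closed[of xs] by auto
    then have "wp (x # xs) \<otimes> t = wp ((x # as) @ bs)"
      using Cons.prems *(2) by (simp add: m_assoc)
    then show ?thesis using *(1) by (metis append_Cons)
  qed
qed simp

definition len where "len w = (LEAST n. \<exists>xs. set xs \<subseteq> S \<and> wp xs = w \<and> length xs = n)"

lemma len_le: "set xs \<subseteq> S \<Longrightarrow> len (wp xs) \<le> length xs"
  unfolding len_def by (rule Least_le) blast

lemma obtain_len_word:
  assumes "w \<in> carrier W"
  obtains xs where "set xs \<subseteq> S" "wp xs = w" "length xs = len w"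
proof -
  have "\<exists>n xs. set xs \<subseteq> S \<and> wp xs = w \<and> length xs = n" using word_exists[OF assms] by blast
  from LeastI_ex[OF this, folded len_def] that show thesis by blast
qed

lemma reduced_word_iff:
  "reduced_word W S w xs \<longleftrightarrow> set xs \<subseteq> S \<and> wp xs = w \<and> length xs = len w"
proof
  assume *: "reduced_word W S w xs"
  then have "set xs \<subseteq> S" "wp xs = w" by (auto simp: reduced_word_def)
  moreover from this have "w \<in> carrier W" by auto
  then obtain ys where "set ys \<subseteq> S" "wp ys = w" "length ys = len w"
    by (rule obtain_len_word)
  ultimately show "set xs \<subseteq> S \<and> wp xs = w \<and> length xs = len w"
    using * len_le[of xs] by (force simp: reduced_word_def lists_eq_set)
qed (auto simp: reduced_word_def lists_eq_set dest: len_le)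

text \<open>
  If \<open>t\<close> had even multiplicity in \<open>refls xs\<close>, then, since a word of \<open>t\<close> contains \<open>t\<close> with odd
  multiplicity, \<open>t\<close> would have odd multiplicity in a reduced word of \<open>wp xs \<otimes> t\<close>. Deletion of a letter
  there would give a word of \<open>wp xs\<close> shorter than \<open>len (wp xs \<otimes> t)\<close>, a contradiction. The
  word \<open>xs\<close> is arbitrary, not necessarily reduced, which permits iteration in
  \<open>arrows_subword\<close>.
\<close>

lemma strong_exchange:
  assumes xs: "set xs \<subseteq> S" and t: "t \<in> reflections" and less: "len (wp xs \<otimes> t) < len (wp xs)"
  shows "\<exists>as a bs. xs = as @ a # bs \<and> wp xs \<otimes> t = wp (as @ bs)"
proof -
  have "odd (count_list (refls xs) t)"
  proof (rule ccontr)
    assume ev: "\<not> odd (count_list (refls xs) t)"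
    obtain zs where zs: "set zs \<subseteq> S" "wp zs = t" "odd (count_list (refls zs) t)"
      using reflection_word t by blast
    obtain ys where ys: "set ys \<subseteq> S" "wp ys = wp xs \<otimes> t" "length ys = len (wp xs \<otimes> t)"
      by (rule obtain_len_word[of "wp xs \<otimes> t"]) (use xs t in simp)
    have "conjugate (inv t) t = t" using t by (simp add: conjugate_def m_assoc)
    then have "odd (count_list (refls (xs @ zs)) t)"
      using xs zs ev t by (simp add: count_refls_append)
    then have "odd (count_list (refls ys) t)"
      using refls_parity[of "xs @ zs" ys] xs ys zs by simp
    then have "t \<in> set (refls ys)" by (metis count_list_0_iff even_zero)
    then obtain as a bs where *: "ys = as @ a # bs" "wp ys \<otimes> t = wp (as @ bs)"
      using refls_delete ys by blast
    have "wp ys \<otimes> t = wp xs" using ys xs t by (simp add: m_assoc reflection_sq)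
    then have "len (wp xs) \<le> length (as @ bs)" using * ys len_le[of "as @ bs"] by auto
    then show False using * ys less by simp
  qed
  then have "t \<in> set (refls xs)" by (metis count_list_0_iff even_zero)
  then show ?thesis using refls_delete xs by blast
qed

lemma len_mult_reflection_ne:
  assumes "w \<in> carrier W" "t \<in> reflections"
  shows "len (w \<otimes> t) \<noteq> len w"
proof -
  obtain xs where xs: "set xs \<subseteq> S" "wp xs = w" "length xs = len w" by (rule obtain_len_word[OF assms(1)])
  obtain ys where ys: "set ys \<subseteq> S" "wp ys = w \<otimes> t" "length ys = len (w \<otimes> t)"
      by (rule obtain_len_word[of "w \<otimes> t"]) (use assms in simp)
  obtain zs where zs: "set zs \<subseteq> S" "wp zs = t" "odd (length zs)" using reflection_word assms by blast
  have "even (length (xs @ zs)) = even (length ys)"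
    by (rule word_parity) (use xs ys zs in auto)
  then show ?thesis using xs ys zs by auto
qed

lemma len_mult_gen_ne: "w \<in> carrier W \<Longrightarrow> s \<in> S \<Longrightarrow> len (w \<otimes> s) \<noteq> len w"
  by (simp add: len_mult_reflection_ne gen_reflection)

lemma len_mult_gen_le:
  assumes "w \<in> carrier W" "s \<in> S"
  shows "len (w \<otimes> s) \<le> len w + 1"
proof -
  obtain xs where xs: "set xs \<subseteq> S" "wp xs = w" "length xs = len w" by (rule obtain_len_word[OF assms(1)])
  show ?thesis using len_le[of "xs @ [s]"] xs assms by simp
qed

lemma mult_gen_twice [simp]: "w \<in> carrier W \<Longrightarrow> s \<in> S \<Longrightarrow> w \<otimes> s \<otimes> s = w"
  by (simp add: m_assoc)

text \<open>
  The deletion property: appending a letter either lengthens a reduced word by one or, by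
  exchange, amounts to the deletion of an earlier letter.
\<close>

lemma reduced_subword:
  assumes "set xs \<subseteq> S"
  shows "\<exists>ys. reduced_word W S (wp xs) ys \<and> subseq ys xs"
  using assms
proof (induction xs rule: rev_induct)
  case Nil
  then show ?case using len_le[of "[]"] by (intro exI[of _ "[]"]) (auto simp: reduced_word_iff)
next
  case (snoc s xs)
  then obtain ys where ys: "set ys \<subseteq> S" "wp ys = wp xs" "length ys = len (wp xs)" "subseq ys xs"
    by (auto simp: reduced_word_iff)
  have s: "s \<in> S" "set xs \<subseteq> S" using snoc by auto
  show ?case
  proof (cases "len (wp xs \<otimes> s) < len (wp xs)")
    case True
    then obtain as a bs where *: "ys = as @ a # bs" "wp ys \<otimes> s = wp (as @ bs)"
      using strong_exchange[of ys s] ys s gen_reflection by auto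
    have "subseq (as @ bs) ys" unfolding * by (intro list_emb_append_mono) auto
    then have sub: "subseq (as @ bs) (xs @ [s])"
      using ys(4) by (meson subseq_order.trans subseq_rev_drop_many subseq_order.refl)
    have "len (wp xs) \<le> len (wp xs \<otimes> s) + 1"
      using len_mult_gen_le[of "wp xs \<otimes> s" s] s by simp
    then have "reduced_word W S (wp (xs @ [s])) (as @ bs)"
      using * ys s True by (auto simp: reduced_word_iff)
    then show ?thesis using sub by blast
  next
    case False
    then have "len (wp xs \<otimes> s) = len (wp xs) + 1"
      using len_mult_gen_ne[of "wp xs" s] len_mult_gen_le[of "wp xs" s] s by fastforce
    then have "reduced_word W S (wp (xs @ [s])) (ys @ [s])"
      using ys s by (auto simp: reduced_word_iff)
    then show ?thesis using ys(4) by (intro exI[of _ "ys @ [s]"]) simp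
  qed
qed

section \<open>The lifting property of the Bruhat order\<close>

text \<open>
  The edges of the Bruhat graph. Their reflexive transitive closure is the Bruhat order
  (\<open>bruhat_le_iff\<close>); transitivity and antisymmetry, which are not apparent from the definition by
  subwords of some reduced word, are immediate for it.
\<close>

definition arrow where
  "arrow v w \<longleftrightarrow> v \<in> carrier W \<and> (\<exists>t\<in>reflections. w = v \<otimes> t) \<and> len v < len w"

lemma arrow_gen: "v \<in> carrier W \<Longrightarrow> s \<in> S \<Longrightarrow> len v < len (v \<otimes> s) \<Longrightarrow> arrow v (v \<otimes> s)"
  using gen_reflection by (auto simp: arrow_def)

lemma arrow_gen': "v \<in> carrier W \<Longrightarrow> s \<in> S \<Longrightarrow> len (v \<otimes> s) < len v \<Longrightarrow> arrow (v \<otimes> s) v"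
  using arrow_gen[of "v \<otimes> s" s] by auto

lemma arrow_carrier: "arrow v w \<Longrightarrow> v \<in> carrier W \<and> w \<in> carrier W"
  by (auto simp: arrow_def)

lemma arrows_len: "arrow\<^sup>*\<^sup>* v w \<Longrightarrow> len v < len w \<or> v = w"
  by (induction rule: rtranclp_induct) (auto simp: arrow_def)

lemma arrows_carrier: "arrow\<^sup>*\<^sup>* v w \<Longrightarrow> w \<in> carrier W \<longleftrightarrow> v \<in> carrier W"
  by (induction rule: rtranclp_induct) (auto dest: arrow_carrier)

text \<open>
  The case that needs an argument is \<open>v < v s\<close> with \<open>w = v t\<close> and \<open>t \<noteq> s\<close>. If \<open>w s\<close> were shorter than
  \<open>v s\<close>, then strong exchange would obtain \<open>w s\<close> by deletion of a letter from a reduced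
  word of \<open>v\<close> followed by \<open>s\<close>. This letter is not the last one because \<open>w s \<noteq> v\<close>, so \<open>w\<close> itself would
  be a reduced word of \<open>v\<close> with a letter deleted, and shorter than \<open>v\<close>.
\<close>

lemma arrow_lift:
  assumes "arrow v w" "s \<in> S"
  shows "arrow\<^sup>*\<^sup>* (v \<otimes> s) w \<or> arrow\<^sup>*\<^sup>* (v \<otimes> s) (w \<otimes> s)"
proof -
  obtain t where v: "v \<in> carrier W" and t: "t \<in> reflections" "w = v \<otimes> t" and less: "len v < len w"
    using assms by (auto simp: arrow_def)
  have w: "w \<in> carrier W" using v t by auto
  have [simp]: "s \<in> carrier W" "t \<in> carrier W" using assms t by auto
  consider "t = s" | "len (v \<otimes> s) < len v" | "t \<noteq> s" "len v < len (v \<otimes> s)"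
    using len_mult_gen_ne[OF v assms(2)] by linarith
  then show ?thesis
  proof cases
    case 1
    then show ?thesis using t by auto
  next
    case 2
    then have "arrow (v \<otimes> s) v" using arrow_gen' v assms by blast
    then show ?thesis using assms(1) by (meson converse_rtranclp_into_rtranclp r_into_rtranclp)
  next
    case 3
    let ?t = "conjugate s t"
    have t': "?t \<in> reflections" using t by (simp add: conjugate_reflection)
    have ws: "w \<otimes> s = (v \<otimes> s) \<otimes> ?t"
    proof -
      have "(v \<otimes> s) \<otimes> ?t = v \<otimes> (s \<otimes> s) \<otimes> t \<otimes> s"
        using v assms t by (simp add: conjugate_def m_assoc del: gen_sq)
      then show ?thesis using v assms t by simp
    qed
    have "len (v \<otimes> s) < len (w \<otimes> s)"
    proof (rule ccontr)
      assume "\<not> len (v \<otimes> s) < len (w \<otimes> s)"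
      then have less': "len (w \<otimes> s) < len (v \<otimes> s)"
        using len_mult_reflection_ne[of "v \<otimes> s" ?t] t' v ws by simp
      obtain xs where xs: "set xs \<subseteq> S" "wp xs = v" "length xs = len v" by (rule obtain_len_word[OF v])
      have vs: "wp (xs @ [s]) = v \<otimes> s" using xs assms by simp
      then obtain as a bs where *: "xs @ [s] = as @ a # bs" "v \<otimes> s \<otimes> ?t = wp (as @ bs)"
        using strong_exchange[of "xs @ [s]" ?t] xs assms t' vs ws less' by auto
      show False
      proof (cases bs rule: rev_cases)
        case Nil
        then have "w \<otimes> s = v" using * ws xs by simp
        then have "w = v \<otimes> s" using w assms by (metis mult_gen_twice)
        then show False using 3 t v assms by simp
      next
        case (snoc bs' b)
        then have "b = s" "xs = as @ a # bs'" using * by auto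
        then have "wp (as @ bs) = wp (as @ bs') \<otimes> s" using snoc xs assms by (simp add: m_assoc)
        then have "w \<otimes> s \<otimes> s = wp (as @ bs') \<otimes> s \<otimes> s" using * ws by simp
        then have "w = wp (as @ bs')" using w assms xs \<open>xs = as @ a # bs'\<close> by (simp add: m_assoc)
        then have "len w \<le> length (as @ bs')" using len_le[of "as @ bs'"] xs \<open>xs = as @ a # bs'\<close> by auto
        then show False using less xs \<open>xs = as @ a # bs'\<close> by simp
      qed
    qed
    then have "arrow (v \<otimes> s) (w \<otimes> s)" using ws t' v by (auto simp: arrow_def)
    then show ?thesis by blast
  qed
qed

lemma arrows_lift:
  assumes "arrow\<^sup>*\<^sup>* v w" "s \<in> S"
  shows "arrow\<^sup>*\<^sup>* (v \<otimes> s) w \<or> arrow\<^sup>*\<^sup>* (v \<otimes> s) (w \<otimes> s)"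
  using assms(1)
proof (induction rule: rtranclp_induct)
  case (step y z)
  show ?case
    using step.IH
  proof
    assume "arrow\<^sup>*\<^sup>* (v \<otimes> s) (y \<otimes> s)"
    then show ?thesis using arrow_lift[OF step.hyps(2) assms(2)] by (meson rtranclp_trans)
  qed (use step.hyps in auto)
qed simp

text \<open>
  Each step down the Bruhat graph deletes a letter, by \<open>strong_exchange\<close>. The words on the way
  need not be reduced.
\<close>

lemma arrows_subword:
  assumes "arrow\<^sup>*\<^sup>* v w" "set xs \<subseteq> S" "wp xs = w"
  shows "\<exists>ys. subseq ys xs \<and> wp ys = v"
  using assms
proof (induction arbitrary: xs rule: rtranclp_induct)
  case base
  then show ?case by blast
next
  case (step y z)
  obtain t where yt: "t \<in> reflections" "z = y \<otimes> t" "y \<in> carrier W" "len y < len z"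
    using step.hyps(2) by (auto simp: arrow_def)
  then have "z \<otimes> t = y" by (simp add: m_assoc reflection_sq)
  then obtain as a bs where *: "xs = as @ a # bs" "wp (as @ bs) = y"
    using strong_exchange[of xs t] step.prems yt by auto
  then obtain ys where "subseq ys (as @ bs)" "wp ys = v"
    using step.IH[of "as @ bs"] step.prems by auto
  moreover have "subseq (as @ bs) xs" unfolding * by (intro list_emb_append_mono) auto
  ultimately have "subseq ys xs" "wp ys = v" using subseq_order.trans by auto
  then show ?case by blast
qed

lemma reduced_word_butlast:
  assumes "reduced_word W S w (xs @ [s])"
  shows "reduced_word W S (w \<otimes> s) xs" "len (w \<otimes> s) < len w"
proof -
  have *: "set xs \<subseteq> S" "s \<in> S" "w = wp xs \<otimes> s" "len w = Suc (length xs)"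
    using assms by (auto simp: reduced_word_iff)
  moreover have "w \<otimes> s = wp xs" using * by simp
  moreover have "len w \<le> len (wp xs) + 1" using * len_mult_gen_le[of "wp xs" s] by simp
  ultimately show "reduced_word W S (w \<otimes> s) xs" "len (w \<otimes> s) < len w"
    using len_le[of xs] by (auto simp: reduced_word_iff)
qed

text \<open>
  Induction on the last letter \<open>s\<close> of the reduced word: a subword that uses it is the product of an
  element below \<open>w s\<close> with \<open>s\<close>, and \<open>arrows_lift\<close> keeps it below \<open>w\<close>.
\<close>

lemma subword_arrows:
  assumes "reduced_word W S w xs" "subseq ys xs"
  shows "arrow\<^sup>*\<^sup>* (wp ys) w"
  using assms
proof (induction xs arbitrary: w ys rule: rev_induct)
  case Nil
  then show ?case by (auto simp: reduced_word_iff dest: list_emb_Nil2)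
next
  case (snoc s xs)
  have xs: "set xs \<subseteq> S" "s \<in> S" "w = wp xs \<otimes> s" 
    using snoc.prems(1) by (auto simp: reduced_word_iff)
  have w: "w \<in> carrier W" using xs by simp
  note red = reduced_word_butlast[OF snoc.prems(1)]
  have up: "arrow (w \<otimes> s) w" using red w xs arrow_gen' by blast
  from snoc.prems(2) consider "subseq ys xs" | ys' where "ys = ys' @ [s]" "subseq ys' xs" by (rule subseq_snocE)
  then show ?case
  proof cases
    case 1
    then show ?thesis using snoc.IH[OF red(1)] up by (meson rtranclp.rtrancl_into_rtrancl)
  next
    case 2
    have "set ys' \<subseteq> S" using 2 xs by (meson subseq_set subset_trans)
    then have "wp ys = wp ys' \<otimes> s" using 2 xs by simp
    moreover have "arrow\<^sup>*\<^sup>* (wp ys') (w \<otimes> s)" using snoc.IH[OF red(1)] 2 by blast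
    from arrows_lift[OF this xs(2)] have "arrow\<^sup>*\<^sup>* (wp ys' \<otimes> s) w"
      using up w xs by (auto intro: rtranclp.rtrancl_into_rtrancl)
    ultimately show ?thesis by simp
  qed
qed

lemma bruhat_le_iff: "bruhat_le W S v w \<longleftrightarrow> w \<in> carrier W \<and> arrow\<^sup>*\<^sup>* v w"
proof
  assume "bruhat_le W S v w"
  then obtain xs ys where *: "reduced_word W S w xs" "reduced_word W S v ys" "subseq ys xs"
    unfolding bruhat_le_def by blast
  then have "arrow\<^sup>*\<^sup>* (wp ys) w" using subword_arrows by blast
  then show "w \<in> carrier W \<and> arrow\<^sup>*\<^sup>* v w" using * by (auto simp: reduced_word_iff)
next
  assume *: "w \<in> carrier W \<and> arrow\<^sup>*\<^sup>* v w"
  then obtain xs where xs: "set xs \<subseteq> S" "wp xs = w" "length xs = len w" 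
    using obtain_len_word by blast
  obtain ys where ys: "subseq ys xs" "wp ys = v" using arrows_subword * xs by blast
  then have "set ys \<subseteq> S" using xs by (meson subseq_set subset_trans)
  then obtain zs where "reduced_word W S v zs" "subseq zs ys" using reduced_subword ys by blast
  then show "bruhat_le W S v w"
    unfolding bruhat_le_def using xs ys by (meson reduced_word_iff subseq_order.trans)
qed

lemma bruhat_carrier: "bruhat_le W S v w \<Longrightarrow> v \<in> carrier W \<and> w \<in> carrier W"
  using bruhat_le_iff arrows_carrier by blast

lemma bruhat_refl: "v \<in> carrier W \<Longrightarrow> bruhat_le W S v v"
  by (simp add: bruhat_le_iff)

lemma bruhat_trans: "bruhat_le W S u v \<Longrightarrow> bruhat_le W S v w \<Longrightarrow> bruhat_le W S u w"
  by (meson bruhat_le_iff rtranclp_trans)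

lemma bruhat_antisym: "bruhat_le W S u v \<Longrightarrow> bruhat_le W S v u \<Longrightarrow> u = v"
  using arrows_len by (metis bruhat_le_iff less_asym)

lemma finite_bruhat_lower: "finite {v. bruhat_le W S v w}"
proof (cases "w \<in> carrier W")
  case True
  then obtain xs where xs: "set xs \<subseteq> S" "wp xs = w" using word_exists by blast
  have "{v. bruhat_le W S v w} \<subseteq> wp ` set (subseqs xs)"
    using arrows_subword[OF _ xs] by (force simp: bruhat_le_iff)
  then show ?thesis by (rule finite_subset) simp
qed (simp add: bruhat_le_iff)

lemma bruhat_len: "bruhat_le W S v w \<Longrightarrow> v \<noteq> w \<Longrightarrow> len v < len w"
  using arrows_len bruhat_le_iff by blast

lemma bruhat_gen_cases:
  "w \<in> carrier W \<Longrightarrow> s \<in> S \<Longrightarrow> bruhat_le W S w (w \<otimes> s) \<or> bruhat_le W S (w \<otimes> s) w"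
  using arrow_gen[of w s] arrow_gen'[of w s] len_mult_gen_ne[of w s]
  by (auto simp: bruhat_le_iff neq_iff)

lemma bruhat_lift_down:
  assumes "bruhat_le W S x y" "bruhat_le W S (y \<otimes> s) y" "s \<in> S"
  shows "bruhat_le W S (x \<otimes> s) y"
  using assms arrows_lift[of x y s] by (meson bruhat_le_iff rtranclp_trans)

lemma mult_gen_ne: "w \<in> carrier W \<Longrightarrow> s \<in> S \<Longrightarrow> w \<otimes> s \<noteq> w"
  using len_mult_gen_ne by metis

text \<open>
  Here a reduced word of \<open>y\<close> that ends in \<open>s\<close> is needed: since \<open>x < x s\<close>, no reduced word of \<open>x\<close> ends in
  \<open>s\<close>, so \<open>x\<close> is already a subword of the part that represents \<open>y s\<close>.
\<close>

lemma bruhat_lift_up: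
  assumes "bruhat_le W S x y" "bruhat_le W S (y \<otimes> s) y" "bruhat_le W S x (x \<otimes> s)" "s \<in> S"
  shows "bruhat_le W S x (y \<otimes> s)"
proof -
  have xy: "x \<in> carrier W" "y \<in> carrier W" using assms bruhat_carrier by auto
  then have "y \<otimes> s \<in> carrier W" using assms by simp
  then obtain xs where xs: "set xs \<subseteq> S" "wp xs = y \<otimes> s" "length xs = len (y \<otimes> s)"
    by (rule obtain_len_word)
  have "len y \<le> len (y \<otimes> s) + 1"
    using len_mult_gen_le[of "y \<otimes> s" s] assms xy by simp
  moreover have "wp (xs @ [s]) = y" using xs assms xy by simp
  moreover have "len (y \<otimes> s) < len y"
    using bruhat_len assms mult_gen_ne xy by blast
  moreover obtain ys where ys: "subseq ys (xs @ [s])" "wp ys = x"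
    using arrows_subword[of x y "xs @ [s]"] assms xs calculation(2) by (auto simp: bruhat_le_iff)
  then obtain zs where zs: "reduced_word W S x zs" "subseq zs ys"
    using reduced_subword[of ys] xs(1) assms(4) subseq_set[OF ys(1)] by fastforce
  then have "subseq zs (xs @ [s])" using ys by (meson subseq_order.trans)
  then consider "subseq zs xs" | zs' where "zs = zs' @ [s]" "subseq zs' xs" by (rule subseq_snocE)
  then show ?thesis
  proof cases
    case 1
    then show ?thesis 
      using zs(1) xs unfolding bruhat_le_def reduced_word_iff[of "y \<otimes> s"] by blast
  next
    case 2
    then have "len (x \<otimes> s) < len x" using zs(1) reduced_word_butlast by blast
    then show ?thesis using bruhat_len[OF assms(3)] mult_gen_ne xy assms by fastforce
  qed
qed

end

section \<open>Zipping an interval along a lifting involution\<close>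

text \<open>
  The properties of the Bruhat order and of \<open>\<sigma> x = x s\<close> from which the theorem follows. The
  carrier is left implicit: it consists of the \<open>x\<close> with \<open>x \<preceq> x\<close>.
\<close>

locale lifting_involution =
  fixes le :: "'a \<Rightarrow> 'a \<Rightarrow> bool" (infix "\<preceq>" 50) and \<sigma> :: "'a \<Rightarrow> 'a"
  assumes below_trans: "x \<preceq> y \<Longrightarrow> y \<preceq> z \<Longrightarrow> x \<preceq> z"
    and below_antisym: "x \<preceq> y \<Longrightarrow> y \<preceq> x \<Longrightarrow> x = y"
    and refl_left: "x \<preceq> y \<Longrightarrow> x \<preceq> x"
    and refl_right: "x \<preceq> y \<Longrightarrow> y \<preceq> y"
    and finite_lower: "finite {x. x \<preceq> y}"
    and invol: "x \<preceq> x \<Longrightarrow> \<sigma> (\<sigma> x) = x"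
    and no_fixpoint: "x \<preceq> x \<Longrightarrow> \<sigma> x \<noteq> x"
    and comparable: "x \<preceq> x \<Longrightarrow> x \<preceq> \<sigma> x \<or> \<sigma> x \<preceq> x"
    and lift_down: "x \<preceq> y \<Longrightarrow> \<sigma> y \<preceq> y \<Longrightarrow> \<sigma> x \<preceq> y"
    and lift_up: "x \<preceq> y \<Longrightarrow> \<sigma> y \<preceq> y \<Longrightarrow> x \<preceq> \<sigma> x \<Longrightarrow> x \<preceq> \<sigma> y"
begin

lemma not_up_down: "x \<preceq> \<sigma> x \<Longrightarrow> \<sigma> x \<preceq> x \<Longrightarrow> False"
  using below_antisym no_fixpoint refl_left by metis

lemma up_up: "x \<preceq> y \<Longrightarrow> x \<preceq> \<sigma> x \<Longrightarrow> y \<preceq> \<sigma> y \<Longrightarrow> \<sigma> x \<preceq> \<sigma> y"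
  using below_trans lift_down invol refl_left by metis

lemma down_down: "x \<preceq> y \<Longrightarrow> \<sigma> x \<preceq> x \<Longrightarrow> \<sigma> y \<preceq> y \<Longrightarrow> \<sigma> x \<preceq> \<sigma> y"
  using lift_down lift_up invol refl_left by metis

lemma up_below: "x \<preceq> \<sigma> y \<Longrightarrow> x \<preceq> \<sigma> x \<Longrightarrow> y \<preceq> \<sigma> y \<Longrightarrow> x \<preceq> y"
  using lift_up[of x "\<sigma> y"] invol refl_left by metis

lemma down_below: "x \<preceq> \<sigma> y \<Longrightarrow> \<sigma> x \<preceq> x \<Longrightarrow> y \<preceq> \<sigma> y \<Longrightarrow> \<sigma> x \<preceq> y"
  using down_down[of x "\<sigma> y"] invol refl_left by metis

definition interval where "interval a b = {(x, y). a \<preceq> x \<and> x \<preceq> y \<and> y \<preceq> b}"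

lemma in_interval [simp]: "(x, y) \<in> interval a b \<longleftrightarrow> a \<preceq> x \<and> x \<preceq> y \<and> y \<preceq> b"
  by (simp add: interval_def)

lemma Field_interval: "Field (interval a b) = {x. a \<preceq> x \<and> x \<preceq> b}"
proof
  show "Field (interval a b) \<subseteq> {x. a \<preceq> x \<and> x \<preceq> b}"
    by (auto simp: Field_def intro: below_trans)
  show "{x. a \<preceq> x \<and> x \<preceq> b} \<subseteq> Field (interval a b)"
    by (clarsimp, rule FieldI1) (use refl_right in auto)
qed

end

text \<open>
  The two elements \<open>c0\<close> and \<open>c1\<close> label two layers of copies of elements of the interval. They are
  parameters of type \<open>'a\<close> so that both \<open>[u, w] \<times> [1, s]\<close>, with labels \<open>1\<close> and \<open>s\<close>, and the shaving of
  \<open>[u, w]\<close>, with labels \<open>u\<close> and \<open>u s\<close>, are literally instances of the posets below.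
\<close>

locale lifting_interval = lifting_involution +
  fixes u w c0 c1 :: 'a
  assumes uw: "u \<preceq> w" and u_up: "u \<preceq> \<sigma> u" and w_up: "w \<preceq> \<sigma> w" and markers: "c0 \<noteq> c1"
begin

abbreviation I where "I \<equiv> {x. u \<preceq> x \<and> x \<preceq> w}"

text \<open>
  Mapping \<open>(x, c0)\<close> to \<open>x\<close>, and \<open>(x, c1)\<close> to the larger of \<open>x\<close> and \<open>\<sigma> x\<close>, sends the product onto
  \<open>[u, \<sigma> w]\<close>. The fibres with more than one element are the triples \<open>(v, c0)\<close>, \<open>(\<sigma> v, c1)\<close>,
  \<open>(v, c1)\<close> for the following \<open>v\<close>; each of them is collapsed by one zipping.
\<close>

definition descents where "descents = {x. u \<preceq> x \<and> x \<preceq> w \<and> \<sigma> x \<preceq> x}"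

definition stage_elems where
  "stage_elems K A = K \<times> {c0} \<union> {x \<in> I. x \<notin> A \<and> \<sigma> x \<notin> A} \<times> {c1}"

text \<open>
  The poset reached when the triples of all \<open>v \<in> A\<close> have been zipped. The merged element of the triple
  of \<open>v\<close> is named \<open>(v, c0)\<close>; it lies below \<open>(y, c1)\<close> also when \<open>\<sigma> v \<preceq> y\<close>, through its
  former part \<open>(\<sigma> v, c1)\<close>. The set \<open>K\<close> of elements present in the layer \<open>c0\<close> is all of \<open>[u, w]\<close> for
  the product and a smaller set for the shaving.
\<close>

definition stage where
  "stage K A = {((x, i), (y, j)). (x, i) \<in> stage_elems K A \<and> (y, j) \<in> stage_elems K A \<and>
      (i = j \<and> x \<preceq> y \<or> i = c0 \<and> j = c1 \<and> (x \<preceq> y \<or> x \<in> A \<and> \<sigma> x \<preceq> y))}"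

lemma in_stage_elems [simp]:
  "(x, c0) \<in> stage_elems K A \<longleftrightarrow> x \<in> K"
  "(x, c1) \<in> stage_elems K A \<longleftrightarrow> u \<preceq> x \<and> x \<preceq> w \<and> x \<notin> A \<and> \<sigma> x \<notin> A"
  using markers by (auto simp: stage_elems_def)

lemma stage_elemsE:
  assumes "p \<in> stage_elems K A"
  obtains x where "p = (x, c0)" "x \<in> K"
  | x where "p = (x, c1)" "u \<preceq> x" "x \<preceq> w" "x \<notin> A" "\<sigma> x \<notin> A"
  using assms by (auto simp: stage_elems_def)

lemma in_stage:
  "((x, c0), (y, c0)) \<in> stage K A \<longleftrightarrow> x \<in> K \<and> y \<in> K \<and> x \<preceq> y"
  "((x, c0), (y, c1)) \<in> stage K A \<longleftrightarrow> x \<in> K \<and> (y, c1) \<in> stage_elems K A \<and> (x \<preceq> y \<or> x \<in> A \<and> \<sigma> x \<preceq> y)"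
  "((x, c1), (y, c1)) \<in> stage K A \<longleftrightarrow> (x, c1) \<in> stage_elems K A \<and> (y, c1) \<in> stage_elems K A \<and> x \<preceq> y"
  "((x, c1), (y, c0)) \<notin> stage K A"
  using markers by (auto simp: stage_def stage_elems_def)

lemma I_refl: "u \<preceq> x \<Longrightarrow> x \<preceq> x"
  by (rule refl_right)

lemma Field_stage:
  assumes "K \<subseteq> I"
  shows "Field (stage K A) = stage_elems K A"
proof
  show "Field (stage K A) \<subseteq> stage_elems K A" by (auto simp: Field_def stage_def)
  show "stage_elems K A \<subseteq> Field (stage K A)"
  proof
    fix p assume p: "p \<in> stage_elems K A"
    then have "(p, p) \<in> stage K A"
      by (cases rule: stage_elemsE) (use assms I_refl p in \<open>auto simp: in_stage\<close>)
    then show "p \<in> Field (stage K A)" by (rule FieldI1)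
  qed
qed

lemma finite_I: "finite I"
  using finite_lower[of w] by (rule rev_finite_subset) auto

lemma descent_facts:
  assumes "x \<in> descents"
  shows "u \<preceq> \<sigma> x \<and> \<sigma> x \<preceq> w \<and> x \<preceq> x \<and> \<sigma> (\<sigma> x) = x \<and> \<sigma> x \<noteq> x \<and> \<sigma> x \<preceq> \<sigma> (\<sigma> x) \<and> \<sigma> x \<notin> descents"
proof -
  have x: "u \<preceq> x" "x \<preceq> w" "\<sigma> x \<preceq> x" "x \<preceq> x" using assms refl_left by (auto simp: descents_def)
  have "\<not> x \<preceq> \<sigma> x" using not_up_down x by blast
  then show ?thesis
    using x invol[OF x(4)] no_fixpoint[OF x(4)] lift_up[OF x(1,3) u_up] below_trans[OF x(3,2)] by (simp add: descents_def)
qed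

text \<open>
  Triples are zipped from the bottom upwards. For these \<open>A\<close> no unzipped \<open>(x, c1)\<close> lies below an
  element of the layer \<open>c0\<close>, which is why \<open>stage\<close> relates no such pair.
\<close>

definition lowerset where "lowerset A \<longleftrightarrow> A \<subseteq> descents \<and> (\<forall>x\<in>descents. \<forall>a\<in>A. x \<preceq> a \<longrightarrow> x \<in> A)"

lemma lowersetD: "lowerset A \<Longrightarrow> x \<preceq> a \<Longrightarrow> a \<in> A \<Longrightarrow> u \<preceq> x \<Longrightarrow> \<sigma> x \<preceq> x \<Longrightarrow> x \<in> A"
  unfolding lowerset_def descents_def using below_trans by blast

lemma stage_poset:
  assumes K: "K \<subseteq> I" and A: "lowerset A"
  shows "finite_poset (stage K A)"
proof -
  have fin: "finite (stage_elems K A)"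
    by (rule finite_subset[of _ "I \<times> {c0, c1}"]) (use K finite_I in \<open>auto simp: stage_elems_def\<close>)
  have refl: "Refl (stage K A)"
    unfolding refl_on_def Field_stage[OF K]
  proof
    fix p assume p: "p \<in> stage_elems K A"
    then show "(p, p) \<in> stage K A"
      by (cases rule: stage_elemsE) (use K I_refl p in \<open>auto simp: in_stage\<close>)
  qed
  have anti: "antisym (stage K A)"
    unfolding antisym_def stage_def using markers below_antisym by auto
  have tr: "p1 \<preceq> p3 \<or> p1 \<in> A \<and> \<sigma> p1 \<preceq> p3"
    if 1: "p1 \<preceq> p2" and 2: "p2 \<in> A" "\<sigma> p2 \<preceq> p3" and k: "p1 \<in> K" for p1 p2 p3
  proof -
    have p2: "\<sigma> p2 \<preceq> p2" "p2 \<in> descents" using A 2 by (auto simp: lowerset_def descents_def)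
    have u: "u \<preceq> p1" using K k by auto
    have "p1 \<preceq> \<sigma> p1 \<or> \<sigma> p1 \<preceq> p1" using comparable refl_left[OF 1] by blast
    then show ?thesis
    proof
      assume "p1 \<preceq> \<sigma> p1"
      then show ?thesis using lift_up[OF 1 p2(1)] 2 below_trans by blast
    next
      assume "\<sigma> p1 \<preceq> p1"
      then show ?thesis using lowersetD[OF A 1 2(1) u] down_down[OF 1 _ p2(1)] 2 below_trans by blast
    qed
  qed
  have "trans (stage K A)"
  proof (rule transI)
    fix p q r assume pq: "(p, q) \<in> stage K A" and qr: "(q, r) \<in> stage K A"
    obtain x i y j z k where e: "p = (x, i)" "q = (y, j)" "r = (z, k)" by (metis surj_pair)
    have mem: "(x, i) \<in> stage_elems K A" "(z, k) \<in> stage_elems K A" using pq qr e by (auto simp: stage_def)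
    consider "i = j" "x \<preceq> y" "j = k" "y \<preceq> z"
      | "i = c0" "k = c1" "x \<preceq> y" "y \<preceq> z \<or> y \<in> A \<and> \<sigma> y \<preceq> z"
      | "i = c0" "k = c1" "x \<preceq> y \<or> x \<in> A \<and> \<sigma> x \<preceq> y" "y \<preceq> z"
      using pq qr markers e by (auto simp: stage_def)
    then have "i = k \<and> x \<preceq> z \<or> i = c0 \<and> k = c1 \<and> (x \<preceq> z \<or> x \<in> A \<and> \<sigma> x \<preceq> z)"
    proof cases
      case 1
      then show ?thesis using below_trans by blast
    next
      case 2
      then have "x \<in> K" using mem by simp
      then show ?thesis using 2 below_trans tr by blast
    next
      case 3
      then show ?thesis using below_trans by blast
    qed
    then show "(p, r) \<in> stage K A" using mem e by (simp add: stage_def)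
  qed
  moreover have "stage K A \<subseteq> stage_elems K A \<times> stage_elems K A" by (auto simp: stage_def)
  ultimately show ?thesis
    unfolding finite_poset_def partial_order_on_def preorder_on_def Field_stage[OF K]
    using fin refl anti K Field_stage[OF K, of A]
    by (simp add: refl_on_def)
qed

context
  fixes K A v
  assumes K: "K \<subseteq> I" and A: "lowerset A"
    and vD: "v \<in> descents" and vA: "v \<notin> A" and vK: "v \<in> K"
    and minimal: "\<And>x. x \<in> descents \<Longrightarrow> x \<preceq> v \<Longrightarrow> x \<noteq> v \<Longrightarrow> x \<in> A"
begin

lemma v_facts:
  "u \<preceq> v" "v \<preceq> w" "\<sigma> v \<preceq> v" "u \<preceq> \<sigma> v" "\<sigma> v \<preceq> w" "v \<preceq> v" "\<sigma> v \<preceq> \<sigma> v" "\<sigma> (\<sigma> v) = v" "\<sigma> v \<noteq> v"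
  "\<sigma> v \<notin> A" "v \<notin> A"
  using vD vA descent_facts[of v] A refl_right[of u "\<sigma> v"] by (auto simp: descents_def lowerset_def)

lemma triple_in_stage: "(v, c0) \<in> stage_elems K A" "(\<sigma> v, c1) \<in> stage_elems K A" "(v, c1) \<in> stage_elems K A"
  using v_facts vK by auto

text \<open>
  By minimality of \<open>v\<close>, all smaller descents are zipped. An \<open>x \<preceq> v\<close> is a descent or becomes one,
  \<open>\<sigma> x \<preceq> v\<close>, by lifting; so in the layer \<open>c1\<close> only \<open>v\<close> and \<open>\<sigma> v\<close> are left below \<open>v\<close>.
\<close>

lemma unzipped_below:
  assumes "u \<preceq> x" "x \<preceq> v" "x \<notin> A" "\<sigma> x \<notin> A"
  shows "x = v \<or> x = \<sigma> v"
proof -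
  have xw: "x \<preceq> w" "x \<preceq> x" using assms v_facts below_trans refl_left by blast+
  show ?thesis
  proof (cases "\<sigma> x \<preceq> x")
    case True
    then show ?thesis using minimal[of x] assms xw by (auto simp: descents_def)
  next
    case False
    then have up: "x \<preceq> \<sigma> x" using comparable xw by blast
    have "\<sigma> x \<preceq> v" using lift_down assms v_facts by blast
    moreover from this have "\<sigma> x \<preceq> w" "u \<preceq> \<sigma> x" using assms up v_facts below_trans by blast+
    then have "\<sigma> x \<in> descents" using up invol[OF xw(2)] by (simp add: descents_def)
    ultimately have "\<sigma> x = v" using minimal assms by blast
    then show ?thesis using invol xw by auto
  qed
qed

text \<open>
  This is the reason for the third zipper condition, that \<open>(v, c0)\<close> and \<open>(\<sigma> v, c1)\<close> have the same
  elements strictly below them. A non-descent below \<open>v\<close> lies below \<open>\<sigma> v\<close> by lifting. A descent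
  \<open>x \<noteq> v\<close> below \<open>v\<close> has been merged with \<open>(\<sigma> x, c1)\<close>, and \<open>\<sigma> x \<preceq> \<sigma> v\<close>.
\<close>

lemma below_sv_iff:
  assumes x: "x \<in> K"
  shows "x \<preceq> \<sigma> v \<or> x \<in> A \<and> \<sigma> x \<preceq> \<sigma> v \<longleftrightarrow> x \<preceq> v \<and> x \<noteq> v"
proof
  assume "x \<preceq> \<sigma> v \<or> x \<in> A \<and> \<sigma> x \<preceq> \<sigma> v"
  then show "x \<preceq> v \<and> x \<noteq> v"
  proof
    assume "x \<preceq> \<sigma> v"
    then show ?thesis using v_facts below_trans below_antisym by metis
  next
    assume *: "x \<in> A \<and> \<sigma> x \<preceq> \<sigma> v"
    then have "\<sigma> (\<sigma> x) \<preceq> v" using v_facts below_trans lift_down by blast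
    then show ?thesis using * A descent_facts[of x] v_facts by (auto simp: lowerset_def)
  qed
next
  assume *: "x \<preceq> v \<and> x \<noteq> v"
  then have "x \<preceq> \<sigma> x \<or> \<sigma> x \<preceq> x" using comparable refl_left by blast
  then show "x \<preceq> \<sigma> v \<or> x \<in> A \<and> \<sigma> x \<preceq> \<sigma> v"
  proof
    assume "x \<preceq> \<sigma> x"
    then show ?thesis using lift_up * v_facts by blast
  next
    assume d: "\<sigma> x \<preceq> x"
    then have "x \<in> descents" using K x by (auto simp: descents_def)
    then show ?thesis using minimal * down_down d v_facts by blast
  qed
qed

lemma underS_v0: "underS (stage K A) (v, c0) = {x \<in> K. x \<preceq> v \<and> x \<noteq> v} \<times> {c0}"
  using vK by (auto simp: underS_def in_stage elim!: stage_elemsE) (auto simp: stage_def stage_elems_def markers markers[symmetric])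

lemma underS_sv1: "underS (stage K A) (\<sigma> v, c1) = {x \<in> K. x \<preceq> v \<and> x \<noteq> v} \<times> {c0}" (is "?L = ?R")
proof
  show "?R \<subseteq> ?L"
    using markers triple_in_stage below_sv_iff by (auto simp: underS_def in_stage)
  show "?L \<subseteq> ?R"
  proof
    fix p assume "p \<in> ?L"
    then have p: "p \<noteq> (\<sigma> v, c1)" "(p, (\<sigma> v, c1)) \<in> stage K A" by (auto simp: underS_def)
    then have "p \<in> stage_elems K A" by (auto simp: stage_def)
    then show "p \<in> ?R"
    proof (cases rule: stage_elemsE)
      case (1 x)
      then show ?thesis using p below_sv_iff by (auto simp: in_stage)
    next
      case (2 x)
      then have "x \<preceq> \<sigma> v" using p by (auto simp: in_stage)
      then have "x \<preceq> v" using v_facts below_trans by blast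
      then show ?thesis using unzipped_below[of x] 2 p \<open>x \<preceq> \<sigma> v\<close> v_facts below_antisym by auto
    qed
  qed
qed

lemma underS_v1:
  "underS (stage K A) (v, c1) = {x \<in> K. x \<preceq> v} \<times> {c0} \<union> {(\<sigma> v, c1)}" (is "?L = ?R")
proof
  show "?R \<subseteq> ?L"
    using markers triple_in_stage v_facts by (auto simp: underS_def in_stage)
  show "?L \<subseteq> ?R"
  proof
    fix p assume "p \<in> ?L"
    then have p: "p \<noteq> (v, c1)" "(p, (v, c1)) \<in> stage K A" by (auto simp: underS_def)
    then have "p \<in> stage_elems K A" by (auto simp: stage_def)
    then show "p \<in> ?R"
    proof (cases rule: stage_elemsE)
      case (1 x)
      then have "x \<preceq> v \<or> x \<in> A \<and> \<sigma> x \<preceq> v" using p by (auto simp: in_stage)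
      moreover have "x \<preceq> v" if "x \<in> A" "\<sigma> x \<preceq> v"
        using lift_down[OF that(2)] v_facts descent_facts[of x] A that by (auto simp: lowerset_def)
      ultimately show ?thesis using 1 by auto
    next
      case (2 x)
      then show ?thesis using unzipped_below[of x] p by (auto simp: in_stage)
    qed
  qed
qed

lemma stage_zipper: "zipper (stage K A) (v, c0) (\<sigma> v, c1) (v, c1)"
  unfolding zipper_def
proof (intro conjI allI)
  show "finite_poset (stage K A)" using stage_poset K A .
  show "{(v, c0), (\<sigma> v, c1), (v, c1)} \<subseteq> Field (stage K A)"
    using triple_in_stage Field_stage[OF K] by auto
  show "distinct [(v, c0), (\<sigma> v, c1), (v, c1)]" using markers v_facts by auto
  show "underS (stage K A) (v, c0) = underS (stage K A) (\<sigma> v, c1)"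
    by (simp add: underS_v0 underS_sv1)
  show "poset_covers (stage K A) (v, c1) p \<longleftrightarrow> p = (v, c0) \<or> p = (\<sigma> v, c1)" for p
  proof
    assume *: "poset_covers (stage K A) (v, c1) p"
    show "p = (v, c0) \<or> p = (\<sigma> v, c1)"
    proof (rule ccontr)
      assume n: "\<not> ?thesis"
      then have "p \<in> underS (stage K A) (v, c0)"
        using * unfolding poset_covers_def underS_v1 underS_v0 by auto
      moreover have "(v, c0) \<in> underS (stage K A) (v, c1)"
        using vK v_facts by (auto simp: underS_v1)
      ultimately show False using * unfolding poset_covers_def by blast
    qed
  next
    assume "p = (v, c0) \<or> p = (\<sigma> v, c1)"
    then have p: "p \<in> underS (stage K A) (v, c1)" using vK v_facts by (auto simp: underS_v1)
    have "p \<notin> underS (stage K A) q" if "q \<in> underS (stage K A) (v, c1)" for q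
    proof
      assume pq: "p \<in> underS (stage K A) q"
      consider x where "q = (x, c0)" "x \<in> K" "x \<preceq> v" | "q = (\<sigma> v, c1)"
        using \<open>q \<in> _\<close> unfolding underS_v1 by auto
      then show False
      proof cases
        case 1
        then show False using pq \<open>p = (v, c0) \<or> p = (\<sigma> v, c1)\<close> below_antisym[OF \<open>x \<preceq> v\<close>]
          by (auto simp: underS_def in_stage)
      next
        case 2
        then show False using pq \<open>p = (v, c0) \<or> p = (\<sigma> v, c1)\<close> markers
          by (auto simp: underS_sv1)
      qed
    qed
    then show "poset_covers (stage K A) (v, c1) p" using p unfolding poset_covers_def by blast
  qed
  show "is_least (stage K A) (above (stage K A) (v, c0) \<inter> above (stage K A) (\<sigma> v, c1)) (v, c1)"
    unfolding is_least_def
  proof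
    show "(v, c1) \<in> above (stage K A) (v, c0) \<inter> above (stage K A) (\<sigma> v, c1)"
      using triple_in_stage v_facts vK by (auto simp: above_def in_stage)
    show "\<forall>q\<in>above (stage K A) (v, c0) \<inter> above (stage K A) (\<sigma> v, c1). ((v, c1), q) \<in> stage K A"
    proof
      fix q assume "q \<in> above (stage K A) (v, c0) \<inter> above (stage K A) (\<sigma> v, c1)"
      then have *: "((v, c0), q) \<in> stage K A" "((\<sigma> v, c1), q) \<in> stage K A" by (auto simp: above_def)
      then have "q \<in> stage_elems K A" by (auto simp: stage_def)
      then show "((v, c1), q) \<in> stage K A"
        by (cases rule: stage_elemsE) (use * v_facts in \<open>auto simp: in_stage\<close>)
    qed
  qed
qed

lemma stage_elems_insert: "stage_elems K A = stage_elems K (insert v A) \<union> {(v, c0), (\<sigma> v, c1), (v, c1)}"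
  "stage_elems K (insert v A) \<inter> {(\<sigma> v, c1), (v, c1)} = {}"
proof -
  have *: "x = \<sigma> v" if "\<sigma> x = v" "u \<preceq> x" for x
    using that invol[OF refl_right] by metis
  have "{x \<in> I. x \<notin> A \<and> \<sigma> x \<notin> A} = {x \<in> I. x \<notin> insert v A \<and> \<sigma> x \<notin> insert v A} \<union> {v, \<sigma> v}"
  proof (intro Set.set_eqI iffI)
    fix x assume "x \<in> {x \<in> I. x \<notin> A \<and> \<sigma> x \<notin> A}"
    then show "x \<in> {x \<in> I. x \<notin> insert v A \<and> \<sigma> x \<notin> insert v A} \<union> {v, \<sigma> v}" using *[of x] by blast
  qed (use v_facts in auto)
  then show "stage_elems K A = stage_elems K (insert v A) \<union> {(v, c0), (\<sigma> v, c1), (v, c1)}"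
    unfolding stage_elems_def using vK by simp blast
  show "stage_elems K (insert v A) \<inter> {(\<sigma> v, c1), (v, c1)} = {}"
    using markers v_facts by (auto simp: stage_elems_def)
qed

text \<open>
  The isomorphism names the new element \<open>(v, c0)\<close> and keeps the names of the others.
\<close>

lemma zip_stage: 
  "poset_iso (zip_poset (stage K A) (v, c0) (\<sigma> v, c1) (v, c1)) (stage K (insert v A))"
    (is "poset_iso ?Z ?Q")
proof -
  let ?R = "stage_elems K A - {(v, c0), (\<sigma> v, c1), (v, c1)}"
  let ?f = "case_option (v, c0) id"
  have R: "?R = stage_elems K (insert v A) - {(v, c0)}" using stage_elems_insert by auto
  have Z: "(None, None) \<in> ?Z"
     "(Some a, Some b) \<in> ?Z \<longleftrightarrow> a \<in> ?R \<and> b \<in> ?R \<and> (a, b) \<in> stage K A"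
     "(None, Some a) \<in> ?Z \<longleftrightarrow> a \<in> ?R \<and> (((v, c0), a) \<in> stage K A \<or> ((\<sigma> v, c1), a) \<in> stage K A)"
     "(Some a, None) \<in> ?Z \<longleftrightarrow> a \<in> ?R \<and> (a, (v, c0)) \<in> stage K A" for a b
    by (simp_all only: in_zip_poset Field_stage[OF K])
  have "finite_poset (stage K A)" using stage_poset K A .
  then have FZ: "Field ?Z = insert None (Some ` ?R)"
    using Field_zip_poset[of "stage K A"] Field_stage[OF K, of A]
    by (auto simp: finite_poset_def partial_order_on_def preorder_on_def)
  show ?thesis
  proof (rule poset_isoI)
    have "bij_betw ?f (insert None (Some ` ?R)) (stage_elems K (insert v A))"
      unfolding R using vK by (auto simp: bij_betw_def inj_on_def image_iff)
    then show "bij_betw ?f (Field ?Z) (Field ?Q)" unfolding FZ Field_stage[OF K] .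
    have SS: "(a, b) \<in> stage K A \<longleftrightarrow> (a, b) \<in> ?Q" if "a \<in> ?R" "b \<in> ?R" for a b
    proof -
      have "a \<in> stage_elems K (insert v A)" "b \<in> stage_elems K (insert v A)" "a \<noteq> (v, c0)" using that R by auto
      then show ?thesis using that unfolding stage_def by (auto split: prod.splits)
    qed
    have NS: "((v, c0), b) \<in> stage K A \<or> ((\<sigma> v, c1), b) \<in> stage K A \<longleftrightarrow> ((v, c0), b) \<in> ?Q" 
      if "b \<in> ?R" for b
    proof -
      have "b \<in> stage_elems K (insert v A)" "b \<in> stage_elems K A" using that R by auto
      then show ?thesis
        by (cases rule: stage_elemsE) (use vK v_facts triple_in_stage in \<open>auto simp: in_stage\<close>)
    qed
    have SN: "(a, (v, c0)) \<in> stage K A \<longleftrightarrow> (a, (v, c0)) \<in> ?Q" if "a \<in> ?R" for a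
    proof -
      have "a \<in> stage_elems K A" using that by auto
      then show ?thesis by (cases rule: stage_elemsE) (use vK in \<open>auto simp: in_stage\<close>)
    qed
    have NN: "((v, c0), (v, c0)) \<in> ?Q" using vK v_facts by (simp add: in_stage)
    fix a b assume "a \<in> Field ?Z" "b \<in> Field ?Z"
    then consider "a = None" "b = None" | b' where "a = None" "b = Some b'" "b' \<in> ?R"
      | a' where "a = Some a'" "b = None" "a' \<in> ?R"
      | a' b' where "a = Some a'" "b = Some b'" "a' \<in> ?R" "b' \<in> ?R"
      unfolding FZ by blast
    then show "(a, b) \<in> ?Z \<longleftrightarrow> (?f a, ?f b) \<in> ?Q"
    proof cases
      case 1
      then show ?thesis using Z(1) NN by simp
    next
      case (2 b')
      then show ?thesis unfolding 2(1,2) option.case id_apply Z(3) using NS by blast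
    next
      case (3 a')
      then show ?thesis unfolding 3(1,2) option.case id_apply Z(4) using SN by blast
    next
      case (4 a' b')
      then show ?thesis unfolding 4(1,2) option.case id_apply Z(2) using SS by blast
    qed
  qed
qed

end

text \<open>
  Zip a descent with the fewest elements below it among those left; every descent strictly below
  it has been treated before.
\<close>

lemma stage_zippings:
  assumes "K \<subseteq> I" "lowerset A" "descents - A \<subseteq> K"
  shows "zipping\<^sup>*\<^sup>* (stage K A) (stage K descents)"
  using assms(2,3)
proof (induction "card (descents - A)" arbitrary: A rule: less_induct)
  case less
  have AD: "A \<subseteq> descents" using less by (simp add: lowerset_def)
  have finD: "finite descents" using finite_I by (rule rev_finite_subset) (auto simp: descents_def)
  show ?case
  proof (cases "descents - A = {}")
    case True
    then have "A = descents" using AD by blast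
    then show ?thesis by simp
  next
    case False
    then obtain v0 where "v0 \<in> descents - A" by blast
    then obtain v where v: "v \<in> descents - A"
      and min: "\<And>x. x \<in> descents - A \<Longrightarrow> card {y. y \<preceq> v} \<le> card {y. y \<preceq> x}"
      using ex_has_least_nat[of "\<lambda>v. v \<in> descents - A" v0 "\<lambda>x. card {y. y \<preceq> x}"] by blast
    have minimal: "x \<in> A" if "x \<in> descents" "x \<preceq> v" "x \<noteq> v" for x
    proof (rule ccontr)
      assume "x \<notin> A"
      have "{y. y \<preceq> x} \<subseteq> {y. y \<preceq> v}" "v \<notin> {y. y \<preceq> x}" "v \<in> {y. y \<preceq> v}"
        using that below_trans below_antisym refl_right by blast+
      then have "{y. y \<preceq> x} \<subset> {y. y \<preceq> v}" by blast
      then have "card {y. y \<preceq> x} < card {y. y \<preceq> v}" using finite_lower psubset_card_mono by blast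
      then show False using min[of x] that \<open>x \<notin> A\<close> by simp
    qed
    have "v \<in> K" using v less by blast
    then have "zipping (stage K A) (stage K (insert v A))"
      unfolding zipping_def
      using stage_zipper[OF assms(1) less.prems(1), of v] zip_stage[OF assms(1) less.prems(1), of v] v minimal
      by blast
    moreover have "zipping\<^sup>*\<^sup>* (stage K (insert v A)) (stage K descents)"
    proof (rule less.hyps)
      have "descents - insert v A \<subset> descents - A" using v by blast
      then show "card (descents - insert v A) < card (descents - A)"
        using finD by (intro psubset_card_mono) auto
      show "lowerset (insert v A)"
        using less.prems(1) v minimal by (auto simp: lowerset_def)
      show "descents - insert v A \<subseteq> K" using less by blast
    qed
    ultimately show ?thesis by (meson converse_rtranclp_into_rtranclp)
  qed
qed

text \<open>
  The map \<open>(x, c0) \<mapsto> x\<close>, \<open>(x, c1) \<mapsto> \<sigma> x\<close> is the isomorphism. It is onto because an element \<open>y\<close> of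
  \<open>[b, \<sigma> w]\<close> that is not below \<open>w\<close> satisfies \<open>\<sigma> y \<preceq> y\<close> and \<open>\<sigma> y \<preceq> w\<close> by lifting.
\<close>

lemma stage_final:
  assumes b: "b = u \<or> b = \<sigma> u"
  shows "poset_iso (stage {x. b \<preceq> x \<and> x \<preceq> w} descents) (interval b (\<sigma> w))"
proof -
  let ?K = "{x. b \<preceq> x \<and> x \<preceq> w}"
  have ub: "u \<preceq> b" using b u_up uw refl_left by auto
  have K: "?K \<subseteq> I" using ub below_trans by auto
  define f where "f = (\<lambda>(x, i). if i = c0 then x else \<sigma> x)"
  have f: "f (x, c0) = x" "f (x, c1) = \<sigma> x" for x using markers by (auto simp: f_def)
  \<comment> \<open>The elements \<open>(x, c1)\<close> that survive all zippings are those for which \<open>\<sigma> x\<close> leaves \<open>[u, w]\<close>;\<close>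
  \<comment> \<open>they parametrize the part of \<open>[b, \<sigma> w]\<close> outside \<open>[b, w]\<close>.\<close>
  have new: "x \<preceq> \<sigma> x \<and> \<sigma> (\<sigma> x) = x \<and> \<not> \<sigma> x \<preceq> w \<and> \<sigma> x \<preceq> \<sigma> w \<and> b \<preceq> \<sigma> x"
    if x: "u \<preceq> x" "x \<preceq> w" "x \<notin> descents" "\<sigma> x \<notin> descents" for x
  proof -
    have xx: "x \<preceq> x" using refl_left x by blast
    have d: "\<not> \<sigma> x \<preceq> x" using x by (simp add: descents_def)
    then have up: "x \<preceq> \<sigma> x" using comparable[OF xx] by blast
    have "u \<preceq> \<sigma> x" using x up below_trans by blast
    then have "\<not> \<sigma> x \<preceq> w" using x(4) up invol[OF xx] by (auto simp: descents_def)
    moreover have "b \<preceq> \<sigma> x" using b \<open>u \<preceq> \<sigma> x\<close> up_up[OF x(1) u_up up] by auto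
    ultimately show ?thesis using invol[OF xx] up_up[OF x(2) up w_up] up by blast
  qed
  have old: "u \<preceq> \<sigma> y \<and> \<sigma> y \<preceq> w \<and> \<sigma> y \<notin> descents \<and> \<sigma> (\<sigma> y) = y \<and> y \<notin> descents"
    if y: "b \<preceq> y" "y \<preceq> \<sigma> w" "\<not> y \<preceq> w" for y
  proof -
    have yy: "y \<preceq> y" using refl_left y by blast
    have uy: "u \<preceq> y" using ub y below_trans by blast
    have n: "\<not> y \<preceq> \<sigma> y" using up_below y w_up by blast
    then have d: "\<sigma> y \<preceq> y" using comparable yy by blast
    have "u \<preceq> \<sigma> y" "\<sigma> y \<preceq> w" using down_below[OF y(2) d w_up] lift_up[OF uy d u_up] by auto
    then show ?thesis
      using invol[OF yy] n y(3) by (simp add: descents_def)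
  qed
  have w_below: "x \<preceq> \<sigma> w" if "x \<preceq> w" for x using below_trans that w_up by blast
  show ?thesis
  proof (rule poset_isoI[of f])
    show "bij_betw f (Field (stage ?K descents)) (Field (interval b (\<sigma> w)))"
      unfolding Field_stage[OF K] Field_interval
    proof (rule bij_betw_byWitness[where f' = "\<lambda>y. if y \<preceq> w then (y, c0) else (\<sigma> y, c1)"])
      show "\<forall>p\<in>stage_elems ?K descents. (if f p \<preceq> w then (f p, c0) else (\<sigma> (f p), c1)) = p"
        by (auto elim!: stage_elemsE simp: f new)
      show "\<forall>y\<in>{x. b \<preceq> x \<and> x \<preceq> \<sigma> w}. f (if y \<preceq> w then (y, c0) else (\<sigma> y, c1)) = y"
        using old by (auto simp: f)
      show "f ` stage_elems ?K descents \<subseteq> {x. b \<preceq> x \<and> x \<preceq> \<sigma> w}"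
        using new w_below by (auto elim!: stage_elemsE simp: f)
      show "(\<lambda>y. if y \<preceq> w then (y, c0) else (\<sigma> y, c1)) ` {x. b \<preceq> x \<and> x \<preceq> \<sigma> w} \<subseteq> stage_elems ?K descents"
        using old by auto
    qed
    fix p q assume pq: "p \<in> Field (stage ?K descents)" "q \<in> Field (stage ?K descents)"
    have bnd: "b \<preceq> f p" "f q \<preceq> \<sigma> w" 
      using pq new w_below unfolding Field_stage[OF K] by (auto elim!: stage_elemsE simp: f)
    have "p \<in> stage_elems ?K descents" "q \<in> stage_elems ?K descents" using pq unfolding Field_stage[OF K] by auto
    then have "(p, q) \<in> stage ?K descents \<longleftrightarrow> f p \<preceq> f q"
    proof (elim stage_elemsE)
      fix x y assume p: "p = (x, c0)" "x \<in> ?K" and q: "q = (y, c0)" "y \<in> ?K"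
      then show ?thesis by (simp add: in_stage f)
    next
      fix x y assume p: "p = (x, c0)" "x \<in> ?K" and q: "q = (y, c1)" "u \<preceq> y" "y \<preceq> w" "y \<notin> descents" "\<sigma> y \<notin> descents"
      have x: "u \<preceq> x" "x \<preceq> w" using K p by auto
      have y: "y \<preceq> \<sigma> y" using new q by blast
      have "x \<preceq> \<sigma> x \<or> \<sigma> x \<preceq> x" using comparable refl_left x by blast
      then have "x \<preceq> \<sigma> y \<longleftrightarrow> x \<preceq> y \<or> x \<in> descents \<and> \<sigma> x \<preceq> y"
      proof
        assume up: "x \<preceq> \<sigma> x"
        then have "x \<notin> descents" using not_up_down by (auto simp: descents_def)
        then show ?thesis using up_below[OF _ up y] below_trans y by blast
      next
        assume d: "\<sigma> x \<preceq> x"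
        then have xD: "x \<in> descents" using x by (auto simp: descents_def)
        have "x \<preceq> \<sigma> y" if "\<sigma> x \<preceq> y" 
          using up_up[OF that _ y] descent_facts[OF xD] by metis
        then show ?thesis using down_below[OF _ d y] xD below_trans y by blast
      qed
      then show ?thesis using p q by (simp add: in_stage f)
    next
      fix x y assume p: "p = (x, c1)" "u \<preceq> x" "x \<preceq> w" "x \<notin> descents" "\<sigma> x \<notin> descents" and q: "q = (y, c0)" "y \<in> ?K"
      then have "\<not> \<sigma> x \<preceq> y" using new below_trans by blast
      then show ?thesis using p q by (simp add: in_stage f)
    next
      fix x y assume p: "p = (x, c1)" "u \<preceq> x" "x \<preceq> w" "x \<notin> descents" "\<sigma> x \<notin> descents" 
        and q: "q = (y, c1)" "u \<preceq> y" "y \<preceq> w" "y \<notin> descents" "\<sigma> y \<notin> descents"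
      have x: "x \<preceq> \<sigma> x" and y: "y \<preceq> \<sigma> y" using new p q by blast+
      have "\<sigma> x \<preceq> \<sigma> y \<longleftrightarrow> x \<preceq> y" using up_up[OF _ x y] up_below[OF below_trans[OF x] x y] by blast
      then show ?thesis using p q by (simp add: in_stage f)
    qed
    then show "(p, q) \<in> stage ?K descents \<longleftrightarrow> (f p, f q) \<in> interval b (\<sigma> w)" using bnd by simp
  qed
qed

text \<open>
  Once \<open>\<sigma> u\<close> counts as zipped, \<open>(\<sigma> u, c0)\<close> is below everything in the layer \<open>c1\<close>, as \<open>(u, c0)\<close> is. So it
  does not matter which of the two serves as the least element. The shaving
  uses \<open>u\<close>, the interval \<open>[\<sigma> u, \<sigma> w]\<close> uses \<open>\<sigma> u\<close>.
\<close>

lemma stage_bottom: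
  assumes descents: "\<sigma> u \<in> descents"
  shows "poset_iso (stage (insert u {x. \<sigma> u \<preceq> x \<and> x \<preceq> w \<and> x \<noteq> \<sigma> u}) descents)
     (stage {x. \<sigma> u \<preceq> x \<and> x \<preceq> w} descents)" (is "poset_iso (stage ?K descents) (stage ?K' descents)")
proof -
  have uu: "u \<preceq> u" "\<sigma> u \<preceq> \<sigma> u" "\<sigma> u \<preceq> w" "\<sigma> (\<sigma> u) = u" "\<not> \<sigma> u \<preceq> u" "\<sigma> u \<noteq> u"
    using u_up refl_left[OF u_up] refl_right[OF u_up] descents invol[OF refl_left[OF u_up]]
      not_up_down[OF u_up] no_fixpoint[OF refl_left[OF u_up]] by (auto simp: descents_def)
  have K: "?K \<subseteq> I" "?K' \<subseteq> I" using uw u_up below_trans uu by blast+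
  let ?f = "\<lambda>p. if p = (u, c0) then (\<sigma> u, c0) else p"
  let ?g = "\<lambda>p. if p = (\<sigma> u, c0) then (u, c0) else p"
  show ?thesis
  proof (rule poset_isoI[of ?f])
    show "bij_betw ?f (Field (stage ?K descents)) (Field (stage ?K' descents))"
      unfolding Field_stage[OF K(1)] Field_stage[OF K(2)]
      by (rule bij_betw_byWitness[where f' = ?g]) (use uu markers in \<open>auto simp: stage_elems_def\<close>)
    fix p q assume "p \<in> Field (stage ?K descents)" "q \<in> Field (stage ?K descents)"
    then have "p \<in> stage_elems ?K descents" "q \<in> stage_elems ?K descents" unfolding Field_stage[OF K(1)] by auto
    then show "(p, q) \<in> stage ?K descents \<longleftrightarrow> (?f p, ?f q) \<in> stage ?K' descents"
    proof (elim stage_elemsE)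
      fix x y assume *: "p = (x, c0)" "x \<in> ?K" "q = (y, c0)" "y \<in> ?K"
      have above: "u \<preceq> z \<and> \<not> z \<preceq> u \<and> \<not> z \<preceq> \<sigma> u \<and> z \<noteq> u"
        if "\<sigma> u \<preceq> z" "z \<noteq> \<sigma> u" for z
        using that u_up uu(5) below_trans[of u "\<sigma> u" z] below_trans[of "\<sigma> u" z u] below_antisym[of "\<sigma> u" z] by blast
      have x: "x = u \<or> u \<preceq> x \<and> \<not> x \<preceq> u \<and> \<not> x \<preceq> \<sigma> u \<and> x \<noteq> u \<and> \<sigma> u \<preceq> x \<and> x \<noteq> \<sigma> u \<and> x \<preceq> w"
        and y: "y = u \<or> u \<preceq> y \<and> \<not> y \<preceq> u \<and> \<not> y \<preceq> \<sigma> u \<and> y \<noteq> u \<and> \<sigma> u \<preceq> y \<and> y \<noteq> \<sigma> u \<and> y \<preceq> w"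
        using *(2,4) above by blast+
      show ?thesis
        unfolding *(1,3) using x y
        by (elim disjE conjE) (simp_all add: in_stage uu uw)
    next
      fix x y assume "p = (x, c0)" "x \<in> ?K" "q = (y, c1)" "u \<preceq> y" "y \<preceq> w" "y \<notin> descents" "\<sigma> y \<notin> descents"
      then show ?thesis using uu markers descents by (auto simp: in_stage)
    qed (use uu markers in \<open>auto simp: in_stage\<close>)
  qed
qed

end


section \<open>Products, shavings and intervals\<close>

context lifting_interval
begin

lemma stage_empty: "stage I {} = poset_prod (interval u w) {(c0, c0), (c0, c1), (c1, c1)}"
proof -
  have "u \<preceq> x \<and> x \<preceq> w \<and> u \<preceq> y \<and> y \<preceq> w \<and> x \<preceq> y \<longleftrightarrow> u \<preceq> x \<and> x \<preceq> y \<and> y \<preceq> w" for x y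
    using below_trans by blast
  then show ?thesis
    using markers by (auto simp: stage_def stage_elems_def poset_prod_def)
qed

lemma poset_bot_interval: "poset_bot (interval u w) = u"
  unfolding poset_bot_def
proof (rule the_equality)
  show "is_least (interval u w) (Field (interval u w)) u"
    using uw I_refl refl_left[OF uw] by (auto simp: is_least_def Field_interval)
  then show "a = u" if "is_least (interval u w) (Field (interval u w)) a" for a
    using that below_antisym unfolding is_least_def in_interval by blast
qed

lemma poset_top_interval: "poset_top (interval u w) = w"
  unfolding poset_top_def
proof (rule the_equality)
  show "is_least ((interval u w)\<inverse>) (Field (interval u w)) w"
    using uw refl_right[OF uw] by (auto simp: is_least_def Field_interval)
  then show "a = w" if "is_least ((interval u w)\<inverse>) (Field (interval u w)) a" for a
    using that below_antisym unfolding is_least_def converse_iff in_interval by blast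
qed

lemma bottom_facts: "u \<preceq> u" "\<sigma> u \<preceq> \<sigma> u" "\<sigma> (\<sigma> u) = u" "\<sigma> u \<noteq> u" "\<not> \<sigma> u \<preceq> u"
  using u_up refl_left[OF u_up] refl_right[OF u_up] invol[OF refl_left[OF u_up]]
    no_fixpoint[OF refl_left[OF u_up]] not_up_down[OF u_up] by auto

lemma lift_bottom: "x \<in> descents \<Longrightarrow> \<sigma> u \<preceq> x"
  using lift_down by (auto simp: descents_def)

lemma lowerset_bottom:
  assumes "\<sigma> u \<in> descents"
  shows "lowerset {\<sigma> u}"
proof -
  have "x = \<sigma> u" if "x \<in> descents" "x \<preceq> \<sigma> u" for x
    using below_antisym[OF that(2) lift_bottom[OF that(1)]] .
  then show ?thesis using assms by (auto simp: lowerset_def)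
qed

text \<open>
  The shaving looks like the product after the triple of \<open>\<sigma> u\<close> has been zipped, cut down to the
  elements above the merged element, except that the latter is called \<open>(u, c0)\<close>.
\<close>

lemma stage_shaving:
  assumes "\<sigma> u \<in> descents" "c0 = u" "c1 = \<sigma> u"
  shows "shaving (interval u w) (\<sigma> u) = stage (insert u {x. \<sigma> u \<preceq> x \<and> x \<preceq> w \<and> x \<noteq> \<sigma> u}) {\<sigma> u}"
    (is "_ = stage ?K _")
proof -
  have suw: "\<sigma> u \<preceq> w" using assms by (simp add: descents_def)
  have eq: "\<sigma> x = \<sigma> u \<longleftrightarrow> x = u" if "u \<preceq> x" for x
    using invol[OF I_refl[OF that]] bottom_facts(3) by metis
  have K: "?K \<subseteq> I" using uw u_up below_trans bottom_facts by blast
  let ?A = "(Field (interval u w) - {u, \<sigma> u}) \<times> {\<sigma> u} \<union>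
      {p. \<sigma> u \<in> underS (interval u w) p \<and> (p, w) \<in> interval u w} \<times> {u} \<union> {(u, u)}"
  have "{p. \<sigma> u \<in> underS (interval u w) p \<and> (p, w) \<in> interval u w} = {x. \<sigma> u \<preceq> x \<and> x \<preceq> w \<and> x \<noteq> \<sigma> u}"
    using u_up below_trans refl_right[OF uw] by (auto simp: underS_def)
  moreover have "A \<union> B \<times> {u} \<union> {(u, u)} = insert u B \<times> {u} \<union> A" for A :: "('a \<times> 'a) set" and B
    by blast
  moreover have "Field (interval u w) - {u, \<sigma> u} = {x \<in> I. x \<notin> {\<sigma> u} \<and> \<sigma> x \<notin> {\<sigma> u}}"
    using eq by (auto simp: Field_interval)
  ultimately have A: "?A = stage_elems ?K {\<sigma> u}"
    unfolding stage_elems_def unfolding assms(2,3) by (simp only:)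
  have "(p, q) \<in> poset_prod (interval u w) (poset_interval (interval u w) u (\<sigma> u)) \<longleftrightarrow> (p, q) \<in> stage ?K {\<sigma> u}"
    if pq: "p \<in> stage_elems ?K {\<sigma> u}" "q \<in> stage_elems ?K {\<sigma> u}" for p q
  proof -
    obtain x i y j where e: "p = (x, i)" "q = (y, j)" by (metis surj_pair)
    have xy: "x \<in> I" "y \<in> I" "x \<noteq> \<sigma> u" and ij: "i = u \<or> i = \<sigma> u" "j = u \<or> j = \<sigma> u"
      using pq K bottom_facts unfolding e stage_elems_def unfolding assms(2,3) by auto
    have "(i, j) \<in> poset_interval (interval u w) u (\<sigma> u) \<longleftrightarrow> i = j \<or> i = u \<and> j = \<sigma> u"
      using ij bottom_facts uw suw u_up by (auto simp: poset_interval_def above_def under_def)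
    then show ?thesis
      using pq xy unfolding e stage_def poset_prod_def unfolding assms(2,3) by auto
  qed
  then show ?thesis
    unfolding shaving_def Let_def poset_bot_interval poset_top_interval A by (auto simp: stage_def)
qed

text \<open>
  If \<open>\<sigma> u\<close> is not below \<open>w\<close>, there is no descent, since a descent lies above \<open>\<sigma> u\<close> by lifting. Hence
  no triple has to be zipped, and \<open>[\<sigma> u, \<sigma> w]\<close> is covered by the layer \<open>c1\<close> alone.
\<close>

lemma disjoint_case:
  assumes "\<not> \<sigma> u \<preceq> w"
  shows "poset_iso (interval u (\<sigma> w)) (poset_prod (interval u w) {(c0, c0), (c0, c1), (c1, c1)})"
    and "poset_iso (interval (\<sigma> u) (\<sigma> w)) (interval u w)"
proof -
  have descents: "descents = {}" using lift_bottom assms below_trans by (fastforce simp: descents_def)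
  show "poset_iso (interval u (\<sigma> w)) (poset_prod (interval u w) {(c0, c0), (c0, c1), (c1, c1)})"
    using stage_final[of u] by (simp add: stage_empty descents poset_iso_sym)
  have K: "{x. \<sigma> u \<preceq> x \<and> x \<preceq> w} = {}" using assms below_trans by blast
  have "poset_iso (interval u w) (stage {} {})"
  proof (rule poset_isoI)
    show "bij_betw (\<lambda>x. (x, c1)) (Field (interval u w)) (Field (stage {} {}))"
      by (subst Field_stage) (auto simp: Field_interval stage_elems_def bij_betw_def inj_on_def)
  qed (auto simp: Field_interval in_stage)
  moreover have "poset_iso (stage {} {}) (interval (\<sigma> u) (\<sigma> w))"
    using stage_final[of "\<sigma> u"] by (simp add: descents K)
  ultimately show "poset_iso (interval (\<sigma> u) (\<sigma> w)) (interval u w)"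
    by (meson poset_iso_sym poset_iso_trans)
qed

lemma product_zips_to_interval:
  "obtained_by_zippings (poset_prod (interval u w) {(c0, c0), (c0, c1), (c1, c1)}) (interval u (\<sigma> w))"
proof -
  have "zipping\<^sup>*\<^sup>* (stage I {}) (stage I descents)"
    by (rule stage_zippings) (auto simp: lowerset_def descents_def)
  then show ?thesis
    unfolding obtained_by_zippings_def stage_empty[symmetric] using stage_final[of u] by blast
qed

lemma shaving_zips_to_interval:
  assumes "\<sigma> u \<preceq> w" "c0 = u" "c1 = \<sigma> u"
  shows "obtained_by_zippings (shaving (interval u w) (\<sigma> u)) (interval (\<sigma> u) (\<sigma> w))"
proof -
  have descents: "\<sigma> u \<in> descents" using assms(1) u_up bottom_facts by (auto simp: descents_def)
  let ?K = "insert u {x. \<sigma> u \<preceq> x \<and> x \<preceq> w \<and> x \<noteq> \<sigma> u}"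
  have "?K \<subseteq> I" using uw u_up below_trans bottom_facts by blast
  moreover have "descents - {\<sigma> u} \<subseteq> ?K" using lift_bottom by (auto simp: descents_def)
  ultimately have "zipping\<^sup>*\<^sup>* (stage ?K {\<sigma> u}) (stage ?K descents)"
    using stage_zippings lowerset_bottom[OF descents] by blast
  moreover have "poset_iso (stage ?K descents) (interval (\<sigma> u) (\<sigma> w))"
    using stage_bottom[OF descents] stage_final[of "\<sigma> u"] poset_iso_trans by blast
  ultimately show ?thesis
    unfolding obtained_by_zippings_def stage_shaving[OF descents assms(2,3)] by blast
qed

end

context coxeter
begin

lemma bruhat_lifting_involution:
  assumes "s \<in> S"
  shows "lifting_involution (bruhat_le W S) (\<lambda>x. x \<otimes> s)"
proof
  fix x y z
  show "bruhat_le W S x y \<Longrightarrow> bruhat_le W S y z \<Longrightarrow> bruhat_le W S x z" by (rule bruhat_trans)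
  show "bruhat_le W S x y \<Longrightarrow> bruhat_le W S y x \<Longrightarrow> x = y" by (rule bruhat_antisym)
  show "bruhat_le W S x y \<Longrightarrow> bruhat_le W S x x" "bruhat_le W S x y \<Longrightarrow> bruhat_le W S y y"
    using bruhat_carrier bruhat_refl by blast+
  show "finite {x. bruhat_le W S x y}" by (rule finite_bruhat_lower)
  show "bruhat_le W S x x \<Longrightarrow> x \<otimes> s \<otimes> s = x" "bruhat_le W S x x \<Longrightarrow> x \<otimes> s \<noteq> x"
    using bruhat_carrier mult_gen_twice mult_gen_ne assms by blast+
  show "bruhat_le W S x x \<Longrightarrow> bruhat_le W S x (x \<otimes> s) \<or> bruhat_le W S (x \<otimes> s) x"
    using bruhat_carrier bruhat_gen_cases assms by blast
  show "bruhat_le W S x y \<Longrightarrow> bruhat_le W S (y \<otimes> s) y \<Longrightarrow> bruhat_le W S (x \<otimes> s) y"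
    using bruhat_lift_down assms by blast
  show "bruhat_le W S x y \<Longrightarrow> bruhat_le W S (y \<otimes> s) y \<Longrightarrow> bruhat_le W S x (x \<otimes> s) \<Longrightarrow>
      bruhat_le W S x (y \<otimes> s)"
    using bruhat_lift_up assms by blast
qed

lemma in_bruhat_interval:
  "(x, y) \<in> bruhat_interval W S a b \<longleftrightarrow> bruhat_le W S a x \<and> bruhat_le W S x y \<and> bruhat_le W S y b"
  using bruhat_carrier bruhat_trans
  unfolding bruhat_interval_def poset_interval_def bruhat_order_def relation_of_def above_def under_def
  by blast

lemma bruhat_interval_gen:
  assumes "s \<in> S"
  shows "bruhat_interval W S \<one> s = {(\<one>, \<one>), (\<one>, s), (s, s)}"
proof -
  have len1: "len \<one> = 0" using len_le[of "[]"] by simp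
  have "s \<noteq> \<one>" using mult_gen_ne[of \<one> s] assms by auto
  have lens: "len s \<le> 1" using len_le[of "[s]"] assms by simp
  have below: "x = \<one> \<or> x = s" if "bruhat_le W S x s" for x
  proof (rule ccontr)
    assume n: "\<not> ?thesis"
    then have "len x = 0" using bruhat_len[OF that] lens by simp
    moreover have "x \<in> carrier W" using bruhat_carrier that by blast
    ultimately obtain xs where "wp xs = x" "length xs = 0" by (metis obtain_len_word)
    then show False using n by simp
  qed
  have "\<not> bruhat_le W S s \<one>" using bruhat_len[of s \<one>] \<open>s \<noteq> \<one>\<close> len1 by auto
  moreover from this have "bruhat_le W S \<one> s" using bruhat_gen_cases[of \<one> s] assms by simp
  moreover have "bruhat_le W S \<one> \<one>" "bruhat_le W S s s" using bruhat_refl assms by auto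
  ultimately have "(x, y) \<in> bruhat_interval W S \<one> s \<longleftrightarrow> (x, y) \<in> {(\<one>, \<one>), (\<one>, s), (s, s)}" for x y
    unfolding in_bruhat_interval using below[of y] below[of x] bruhat_trans[of x y s] by auto
  then show ?thesis by (auto simp: set_eq_iff)
qed

end

theorem theorem5p5:
  fixes W :: "('a, 'b) monoid_scheme" and S :: "'a set" and s u w :: 'a
  assumes "coxeter_system W S" and "s \<in> S" and "u \<in> carrier W" and "w \<in> carrier W"
    and "bruhat_less W S w (w \<otimes>\<^bsub>W\<^esub> s)"
    and "bruhat_less W S u (u \<otimes>\<^bsub>W\<^esub> s)"
    and "bruhat_le W S u w"
  shows "(u \<otimes>\<^bsub>W\<^esub> s \<notin> Field (bruhat_interval W S u w) \<longrightarrow>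
            poset_iso (bruhat_interval W S u (w \<otimes>\<^bsub>W\<^esub> s))
              (poset_prod (bruhat_interval W S u w) (bruhat_interval W S \<one>\<^bsub>W\<^esub> s)) \<and>
            poset_iso (bruhat_interval W S (u \<otimes>\<^bsub>W\<^esub> s) (w \<otimes>\<^bsub>W\<^esub> s))
              (bruhat_interval W S u w)) \<and>
         (u \<otimes>\<^bsub>W\<^esub> s \<in> Field (bruhat_interval W S u w) \<longrightarrow>
            obtained_by_zippings
              (poset_prod (bruhat_interval W S u w) (bruhat_interval W S \<one>\<^bsub>W\<^esub> s))
              (bruhat_interval W S u (w \<otimes>\<^bsub>W\<^esub> s)) \<and>
            obtained_by_zippings
              (shaving (bruhat_interval W S u w) (u \<otimes>\<^bsub>W\<^esub> s))
              (bruhat_interval W S (u \<otimes>\<^bsub>W\<^esub> s) (w \<otimes>\<^bsub>W\<^esub> s)))"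
proof -
  interpret coxeter W S
    using assms(1) by (intro coxeter.intro coxeter_axioms.intro) (auto simp: coxeter_system_def)
  interpret lifting_involution "bruhat_le W S" "\<lambda>x. x \<otimes>\<^bsub>W\<^esub> s"
    using assms(2) by (rule bruhat_lifting_involution)
  have up: "bruhat_le W S w (w \<otimes>\<^bsub>W\<^esub> s)" "bruhat_le W S u (u \<otimes>\<^bsub>W\<^esub> s)" "u \<noteq> u \<otimes>\<^bsub>W\<^esub> s"
    using assms(5,6) by (auto simp: bruhat_less_def)
  have "s \<noteq> \<one>\<^bsub>W\<^esub>" using up(3) assms(3) by auto
  interpret prod: lifting_interval "bruhat_le W S" "\<lambda>x. x \<otimes>\<^bsub>W\<^esub> s" u w "\<one>\<^bsub>W\<^esub>" s
    by unfold_locales (use assms up \<open>s \<noteq> \<one>\<^bsub>W\<^esub>\<close> in auto)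
  interpret shave: lifting_interval "bruhat_le W S" "\<lambda>x. x \<otimes>\<^bsub>W\<^esub> s" u w u "u \<otimes>\<^bsub>W\<^esub> s"
    by unfold_locales (use assms up in auto)
  have interval_eq: "bruhat_interval W S a b = interval a b" for a b
    by (auto simp: set_eq_iff in_bruhat_interval)
  have "u \<otimes>\<^bsub>W\<^esub> s \<in> Field (interval u w) \<longleftrightarrow> bruhat_le W S (u \<otimes>\<^bsub>W\<^esub> s) w"
    using up by (simp add: Field_interval)
  then show ?thesis
    unfolding bruhat_interval_gen[OF assms(2)] unfolding interval_eq
    using prod.disjoint_case prod.product_zips_to_interval
      shave.shaving_zips_to_interval by auto
qed

end
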